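(* Let $K\ge 3$ and let $I$ be a proper subset of $[K]$ with at least two elements. Let $J_1,\dots,J_g$ be nonempty proper subsets of $I$ satisfying $\bigcup_{d=1}^gJ_d=I$. Let $F=\bigcap_{i\in[K]\setminus I}E_i$, and for $d\in[g]$ let $F_d=\bigcap_{j\in J_d}E_j$ and $F_d^{(I)}=\bigcap_{j\in J_d}E_j^{(I)}$. Then $$\sigma\left(P_{F_1\cap F}\cdots P_{F_g\cap F}-\Pi\right)=\sigma\left(P_{F_1^{(I)}}\cdots P_{F_g^{(I)}}-\Pi_I\right),$$ and, for all $(v_1,\dots,v_g)\in(0,1)^g$ with $\sum_{d=1}^gv_d=1$, $$\sigma\left(\sum_{d=1}^gv_dP_{F_d\cap F}-\Pi\right)=\sigma\left(\sum_{d=1}^gv_dP_{F_d^{(I)}}-\Pi_I\right).$$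
   Context: Write $[n]=\{1,\dots,n\}$. For $k\in[K]$ let $\mathcal X_k$ be a complete separable metric space with its Borel $\sigma$-algebra, $\mathcal X=\mathcal X_1\times\cdots\times\mathcal X_K$, and let $\pi$ be a Borel probability measure on $\mathcal X$. $L^2(\pi)$ is the complex Hilbert space of square-integrable measurable functions $\mathcal X\to\mathbb C$ (identified when equal $\pi$-a.e.). For $L\subset[K]$, $x_L$ and $x_{-L}$ are the coordinates of $x$ with indices in $L$, respectively in $[K]\setminus L$, and $\mathcal X_L$ is the product of the $\mathcal X_i$, $i\in L$. $\pi_I$ is the marginal distribution of $\pi$ on $\mathcal X_I$. $\Pi$ on $L^2(\pi)$ maps $f$ to the constant function $\int f\,d\pi$; $\Pi_I$ on $L^2(\pi_I)$ maps $f$ to the constant function $\int f\,d\pi_I$. $E_i$ is the closed subspace of functions in $L^2(\pi)$ constant with respect to the $i$th coordinate; for $j\in I$, $E_j^{(I)}$ is the closed subspace of functions in $L^2(\pi_I)$ constant with respect to the $j$th coordinate. For nonempty $L\subseteq[K]$, $\bigcap_{i\in L}E_i$ is the closed subspace of functions constant with respect to all coordinates in $L$, i.e. of classes having a representative depending only on $x_{-L}$; thus $F_d\cap F=\bigcap_{i\in J_d\cup([K]\setminus I)}E_i$ consists of (classes of) functions of $x_{I\setminus J_d}$. The same convention is used in $L^2(\pi_I)$. $P_S$ is the orthogonal projection onto a closed subspace $S$; for $S=\bigcap_{i\in L}E_i$ with $L$ nonempty and proper it is $(P_Sf)(x)=\int_{\mathcal X_L}f(x_L',x_{-L})\,\pi(dx_L'\mid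 x_{-L})$, with $\pi(\cdot\mid x_{-L})$ the conditional distribution of $X_L$ given $X_{-L}=x_{-L}$, $X\sim\pi$ (and analogously on $L^2(\pi_I)$). $\sigma(T)$ is the spectrum of a bounded operator $T$. *)

theory Defs
  imports "HOL-Probability.Probability"
begin

definition borel_of :: "'a topology \<Rightarrow> 'a measure" where
  "borel_of T = sigma (topspace T) {U. openin T U}"

text \<open>The points of the product over an index set \<open>A\<close> are the functions in
  \<open>\<Pi>\<^sub>E i\<in>A. mspace (X i)\<close>, which take the value \<open>undefined\<close> outside \<open>A\<close>. The metric spaces
  \<open>X i\<close> may be different subsets of the common type.\<close>

definition prod_borel :: "(nat \<Rightarrow> 'a metric) \<Rightarrow> nat set \<Rightarrow> (nat \<Rightarrow> 'a) measure" where
  "prod_borel X A = borel_of (product_topology (\<lambda>i. mtopology_of (X i)) A)"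

definition marginal ::
    "(nat \<Rightarrow> 'a metric) \<Rightarrow> nat set \<Rightarrow> (nat \<Rightarrow> 'a) measure \<Rightarrow> (nat \<Rightarrow> 'a) measure" where
  "marginal X A \<pi> = distr \<pi> (prod_borel X A) (\<lambda>x. restrict x A)"


section \<open>The complex Hilbert space of square-integrable functions\<close>

text \<open>Since the space depends on the measure, it is a set of equivalence classes modulo
  almost-everywhere equality rather than a type, and its operations take the measure as an
  argument. They are computed on chosen representatives and are independent of the choice.\<close>

type_synonym 'x fclass = "('x \<Rightarrow> complex) set"

definition sq_integrable :: "'x measure \<Rightarrow> ('x \<Rightarrow> complex) set" where
  "sq_integrable M = {f \<in> borel_measurable M. integrable M (\<lambda>x. (cmod (f x))\<^sup>2)}"

definition L2_class :: "'x measure \<Rightarrow> ('x \<Rightarrow> complex) \<Rightarrow> 'x fclass" where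
  "L2_class M f = {h \<in> sq_integrable M. AE x in M. h x = f x}"

definition L2 :: "'x measure \<Rightarrow> 'x fclass set" where
  "L2 M = L2_class M ` sq_integrable M"

definition rep :: "'x fclass \<Rightarrow> 'x \<Rightarrow> complex" where
  "rep u = (SOME f. f \<in> u)"

definition L2_add :: "'x measure \<Rightarrow> 'x fclass \<Rightarrow> 'x fclass \<Rightarrow> 'x fclass" where
  "L2_add M u w = L2_class M (\<lambda>x. rep u x + rep w x)"

definition L2_diff :: "'x measure \<Rightarrow> 'x fclass \<Rightarrow> 'x fclass \<Rightarrow> 'x fclass" where
  "L2_diff M u w = L2_class M (\<lambda>x. rep u x - rep w x)"

definition L2_scale :: "'x measure \<Rightarrow> complex \<Rightarrow> 'x fclass \<Rightarrow> 'x fclass" where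
  "L2_scale M c u = L2_class M (\<lambda>x. c * rep u x)"

definition L2_sum :: "'x measure \<Rightarrow> ('i \<Rightarrow> 'x fclass) \<Rightarrow> 'i set \<Rightarrow> 'x fclass" where
  "L2_sum M w D = L2_class M (\<lambda>x. \<Sum>d\<in>D. rep (w d) x)"

definition L2_inner :: "'x measure \<Rightarrow> 'x fclass \<Rightarrow> 'x fclass \<Rightarrow> complex" where
  "L2_inner M u w = (\<integral>x. rep u x * cnj (rep w x) \<partial>M)"

definition L2_norm :: "'x measure \<Rightarrow> 'x fclass \<Rightarrow> real" where
  "L2_norm M u = sqrt (\<integral>x. (cmod (rep u x))\<^sup>2 \<partial>M)"

definition L2_bounded_linear :: "'x measure \<Rightarrow> ('x fclass \<Rightarrow> 'x fclass) \<Rightarrow> bool" where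
  "L2_bounded_linear M T \<longleftrightarrow>
     (\<forall>u\<in>L2 M. T u \<in> L2 M) \<and>
     (\<forall>u\<in>L2 M. \<forall>w\<in>L2 M. T (L2_add M u w) = L2_add M (T u) (T w)) \<and>
     (\<forall>c. \<forall>u\<in>L2 M. T (L2_scale M c u) = L2_scale M c (T u)) \<and>
     (\<exists>C. \<forall>u\<in>L2 M. L2_norm M (T u) \<le> C * L2_norm M u)"

text \<open>The scalars \<open>c\<close> for which \<open>T - c\<close> has no bounded linear two-sided inverse.\<close>

definition L2_spectrum :: "'x measure \<Rightarrow> ('x fclass \<Rightarrow> 'x fclass) \<Rightarrow> complex set" where
  "L2_spectrum M T = {c. \<not> (\<exists>S. L2_bounded_linear M S \<and>
     (\<forall>u\<in>L2 M. S (L2_diff M (T u) (L2_scale M c u)) = u \<and>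
               L2_diff M (T (S u)) (L2_scale M c (S u)) = u))}"

definition L2_proj :: "'x measure \<Rightarrow> 'x fclass set \<Rightarrow> 'x fclass \<Rightarrow> 'x fclass" where
  "L2_proj M S u = (THE p. p \<in> S \<and> (\<forall>s\<in>S. L2_inner M (L2_diff M u p) s = 0))"

definition L2_mean :: "'x measure \<Rightarrow> 'x fclass \<Rightarrow> 'x fclass" where
  "L2_mean M u = L2_class M (\<lambda>_. \<integral>x. rep u x \<partial>M)"

text \<open>The composition \<open>P 1 \<circ> \<dots> \<circ> P g\<close>, in which \<open>P g\<close> is applied first.\<close>

definition op_prod :: "(nat \<Rightarrow> 'v \<Rightarrow> 'v) \<Rightarrow> nat \<Rightarrow> 'v \<Rightarrow> 'v" where
  "op_prod P g = foldr (\<lambda>d T. P d \<circ> T) [1..<Suc g] id"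


section \<open>Functions constant with respect to some coordinates\<close>

text \<open>For a measure on a product, \<open>coord_const M L\<close> is the space written
  \<open>\<Inter>i\<in>L. E\<^sub>i\<close>: the classes with one representative that is constant with respect to all
  coordinates in \<open>L\<close> simultaneously. This can be strictly smaller than the set-theoretic
  intersection of the spaces \<open>coord_const M {i}\<close>, because there the representative may depend
  on \<open>i\<close>. Accordingly \<open>(\<Inter>i\<in>L. E\<^sub>i) \<inter> (\<Inter>i\<in>L'. E\<^sub>i)\<close> stands for \<open>coord_const M (L \<union> L')\<close>.
  Points of the product agree outside its index set, so the quantifier over all \<open>i\<close> not in \<open>L\<close>
  only concerns coordinates in the index set.\<close>

definition coord_const :: "(nat \<Rightarrow> 'a) measure \<Rightarrow> nat set \<Rightarrow> (nat \<Rightarrow> 'a) fclass set" where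
  "coord_const M L = {L2_class M f | f. f \<in> sq_integrable M \<and>
     (\<forall>x\<in>space M. \<forall>y\<in>space M. (\<forall>i. i \<notin> L \<longrightarrow> x i = y i) \<longrightarrow> f x = f y)}"

end

theory Submission
  imports Defs
begin

text \<open>Composition with the restriction \<open>x \<mapsto> x\<^sub>I\<close> is an isometric embedding \<open>\<iota>\<close> of \<open>L\<^sup>2(\<pi>\<^sub>I)\<close> into
  \<open>L\<^sup>2(\<pi>)\<close>. Freezing the coordinates outside \<open>I\<close> at a point of the space gives a measurable section
  of the restriction, which shows that \<open>\<iota>\<close> maps \<open>F\<^sub>d\<^sup>(\<^sup>I\<^sup>)\<close> onto \<open>F\<^sub>d \<inter> F\<close>. With \<open>\<kappa>\<close> the adjoint of
  \<open>\<iota>\<close>, so that \<open>\<kappa> \<circ> \<iota> = id\<close>, every projection onto \<open>F\<^sub>d \<inter> F\<close> is \<open>\<iota> \<circ> P \<circ> \<kappa>\<close> with \<open>P\<close> the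
  projection onto \<open>F\<^sub>d\<^sup>(\<^sup>I\<^sup>)\<close>, and likewise for the means. Hence each operator on \<open>L\<^sup>2(\<pi>)\<close> is
  \<open>\<iota> \<circ> T \<circ> \<kappa>\<close> with \<open>T\<close> its counterpart on \<open>L\<^sup>2(\<pi>\<^sub>I)\<close>, and the spectra agree away from \<open>0\<close>. Both
  contain \<open>0\<close>, because \<open>T\<close> annihilates the constants.\<close>

section \<open>Operations on classes of square-integrable functions\<close>

lemma sq_integrableI:
  "\<lbrakk>f \<in> borel_measurable M; integrable M (\<lambda>x. (cmod (f x))\<^sup>2)\<rbrakk> \<Longrightarrow> f \<in> sq_integrable M"
  by (simp add: sq_integrable_def)

lemma sq_integrable_measurable: "f \<in> sq_integrable M \<Longrightarrow> f \<in> borel_measurable M"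
  and sq_integrable_norm: "f \<in> sq_integrable M \<Longrightarrow> integrable M (\<lambda>x. (cmod (f x))\<^sup>2)"
  by (simp_all add: sq_integrable_def)

text \<open>A crude form of Minkowski's inequality. Its constants are not sharp, but they suffice
  for closure under sums and for boundedness of differences of operators.\<close>

lemma norm_add_power2_le: "(norm (a + b))\<^sup>2 \<le> 2 * (norm a)\<^sup>2 + 2 * (norm b)\<^sup>2"
  for a b :: "'v::real_normed_vector"
proof -
  have "(norm (a + b))\<^sup>2 \<le> (norm a + norm b)\<^sup>2"
    by (simp add: norm_triangle_ineq power_mono)
  also have "\<dots> \<le> 2 * (norm a)\<^sup>2 + 2 * (norm b)\<^sup>2"
    using sum_squares_bound[of "norm a" "norm b"] by (simp add: power2_sum)
  finally show ?thesis .
qed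

lemma sq_integrable_add [simp, intro]:
  assumes "f \<in> sq_integrable M" "g \<in> sq_integrable M"
  shows "(\<lambda>x. f x + g x) \<in> sq_integrable M"
proof (rule sq_integrableI)
  note [measurable] = assms[THEN sq_integrable_measurable]
  show "integrable M (\<lambda>x. (cmod (f x + g x))\<^sup>2)"
    by (rule Bochner_Integration.integrable_bound
        [where f = "\<lambda>x. 2 * (cmod (f x))\<^sup>2 + 2 * (cmod (g x))\<^sup>2"])
      (use assms norm_add_power2_le in \<open>auto simp: sq_integrable_norm\<close>)
qed (use assms[THEN sq_integrable_measurable] in measurable)

lemma sq_integrable_scale [simp, intro]:
  "f \<in> sq_integrable M \<Longrightarrow> (\<lambda>x. c * f x) \<in> sq_integrable M"
  by (auto simp: sq_integrable_def norm_mult power_mult_distrib)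

lemma sq_integrable_divide [simp, intro]:
  "f \<in> sq_integrable M \<Longrightarrow> (\<lambda>x. f x / c) \<in> sq_integrable M"
  using sq_integrable_scale[where c = "1 / c"] by simp

lemma sq_integrable_minus [simp, intro]:
  "f \<in> sq_integrable M \<Longrightarrow> (\<lambda>x. - f x) \<in> sq_integrable M"
  using sq_integrable_scale[where c = "-1"] by simp

lemma sq_integrable_diff [simp, intro]:
  assumes "f \<in> sq_integrable M" "g \<in> sq_integrable M"
  shows "(\<lambda>x. f x - g x) \<in> sq_integrable M"
  using sq_integrable_add[OF assms(1) sq_integrable_minus[OF assms(2)]] by simp

lemma sq_integrable_zero [simp, intro]: "(\<lambda>_. 0) \<in> sq_integrable M"
  by (simp add: sq_integrable_def)

lemma sq_integrable_sum [simp, intro]: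
  assumes "\<And>d. d \<in> D \<Longrightarrow> f d \<in> sq_integrable M"
  shows "(\<lambda>x. \<Sum>d\<in>D. f d x) \<in> sq_integrable M"
  using assms by (induction D rule: infinite_finite_induct) auto

lemma (in finite_measure) sq_integrable_const [simp, intro]: "(\<lambda>_. c) \<in> sq_integrable M"
  by (simp add: sq_integrable_def)

text \<open>Domination by the sum of the squared moduli makes all inner products finite.\<close>

lemma integrable_mult_cnj:
  assumes "f \<in> sq_integrable M" "g \<in> sq_integrable M"
  shows "integrable M (\<lambda>x. f x * cnj (g x))"
proof (rule Bochner_Integration.integrable_bound[where f = "\<lambda>x. (cmod (f x))\<^sup>2 + (cmod (g x))\<^sup>2"])
  show "integrable M (\<lambda>x. (cmod (f x))\<^sup>2 + (cmod (g x))\<^sup>2)"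
    using assms by (simp add: sq_integrable_norm)
  have cnj: "cnj \<in> borel_measurable borel"
    by (intro borel_measurable_continuous_onI continuous_intros)
  show "(\<lambda>x. f x * cnj (g x)) \<in> borel_measurable M"
    using assms[THEN sq_integrable_measurable] measurable_compose[OF _ cnj] by measurable
  have "a * b \<le> a\<^sup>2 + b\<^sup>2" for a b :: real
    using sum_squares_bound[of a b] zero_le_power2[of a] zero_le_power2[of b] by linarith
  then show "AE x in M. norm (f x * cnj (g x)) \<le> norm ((cmod (f x))\<^sup>2 + (cmod (g x))\<^sup>2)"
    by (simp add: norm_mult)
qed

section \<open>Classes modulo null sets and independence of representatives\<close>

lemma L2_class_eq_iff:
  assumes "f \<in> sq_integrable M" "g \<in> sq_integrable M"
  shows "L2_class M f = L2_class M g \<longleftrightarrow> (AE x in M. f x = g x)"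
proof
  assume "L2_class M f = L2_class M g"
  moreover have "f \<in> L2_class M f"
    using assms by (simp add: L2_class_def)
  ultimately show "AE x in M. f x = g x"
    by (auto simp: L2_class_def)
next
  assume *: "AE x in M. f x = g x"
  have "(AE x in M. h x = f x) \<longleftrightarrow> (AE x in M. h x = g x)" for h
    using * by (auto elim: eventually_elim2)
  then show "L2_class M f = L2_class M g"
    by (simp add: L2_class_def)
qed

text \<open>The class contains \<open>f\<close>, so the choice made by \<open>rep\<close> has a
  witness and yields a member. All computation rules for classes rest on this.\<close>

lemma
  assumes "f \<in> sq_integrable M"
  shows sq_integrable_rep_class [simp, intro]: "rep (L2_class M f) \<in> sq_integrable M"
    and AE_rep_class: "AE x in M. rep (L2_class M f) x = f x"
proof -
  have "f \<in> L2_class M f"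
    using assms by (simp add: L2_class_def)
  then have "rep (L2_class M f) \<in> L2_class M f"
    unfolding rep_def by (rule someI[where P = "\<lambda>h. h \<in> L2_class M f"])
  then show "rep (L2_class M f) \<in> sq_integrable M" "AE x in M. rep (L2_class M f) x = f x"
    by (auto simp: L2_class_def)
qed

lemma L2_class_in_L2 [simp, intro]: "f \<in> sq_integrable M \<Longrightarrow> L2_class M f \<in> L2 M"
  by (simp add: L2_def)

lemma L2E:
  assumes "u \<in> L2 M"
  obtains f where "f \<in> sq_integrable M" "u = L2_class M f"
  using assms by (auto simp: L2_def)

lemma sq_integrable_rep: "u \<in> L2 M \<Longrightarrow> rep u \<in> sq_integrable M"
  and L2_class_rep: "u \<in> L2 M \<Longrightarrow> L2_class M (rep u) = u"
  by (erule L2E; simp add: L2_class_eq_iff AE_rep_class)+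

lemma L2_add_class [simp]:
  assumes "f \<in> sq_integrable M" "g \<in> sq_integrable M"
  shows "L2_add M (L2_class M f) (L2_class M g) = L2_class M (\<lambda>x. f x + g x)"
  unfolding L2_add_def using assms AE_rep_class[OF assms(1)] AE_rep_class[OF assms(2)]
  by (subst L2_class_eq_iff) auto

lemma L2_diff_class [simp]:
  assumes "f \<in> sq_integrable M" "g \<in> sq_integrable M"
  shows "L2_diff M (L2_class M f) (L2_class M g) = L2_class M (\<lambda>x. f x - g x)"
  unfolding L2_diff_def using assms AE_rep_class[OF assms(1)] AE_rep_class[OF assms(2)]
  by (subst L2_class_eq_iff) auto

lemma L2_scale_class [simp]:
  assumes "f \<in> sq_integrable M"
  shows "L2_scale M c (L2_class M f) = L2_class M (\<lambda>x. c * f x)"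
  unfolding L2_scale_def using assms AE_rep_class[OF assms(1)]
  by (subst L2_class_eq_iff) auto

lemma L2_sum_class:
  assumes "finite D" "\<And>d. d \<in> D \<Longrightarrow> f d \<in> sq_integrable M"
    and "\<And>d. d \<in> D \<Longrightarrow> w d = L2_class M (f d)"
  shows "L2_sum M w D = L2_class M (\<lambda>x. \<Sum>d\<in>D. f d x)"
proof -
  \<comment> \<open>Finiteness of \<open>D\<close> keeps the union of the exceptional null sets
    null.\<close>
  have "AE x in M. \<forall>d\<in>D. rep (w d) x = f d x"
    by (intro AE_finite_allI assms(1)) (simp add: assms(2,3) AE_rep_class)
  then have "AE x in M. (\<Sum>d\<in>D. rep (w d) x) = (\<Sum>d\<in>D. f d x)"
    by eventually_elim simp
  then show ?thesis
    unfolding L2_sum_def using assms by (subst L2_class_eq_iff) auto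
qed

lemma L2_inner_class [simp]:
  assumes "f \<in> sq_integrable M" "g \<in> sq_integrable M"
  shows "L2_inner M (L2_class M f) (L2_class M g) = (\<integral>x. f x * cnj (g x) \<partial>M)"
  unfolding L2_inner_def
proof (rule integral_cong_AE)
  show "AE x in M. rep (L2_class M f) x * cnj (rep (L2_class M g) x) = f x * cnj (g x)"
    using AE_rep_class[OF assms(1)] AE_rep_class[OF assms(2)] by eventually_elim simp
qed (use assms in \<open>auto intro!: borel_measurable_integrable integrable_mult_cnj\<close>)

lemma L2_norm_class [simp]:
  assumes "f \<in> sq_integrable M"
  shows "L2_norm M (L2_class M f) = sqrt (\<integral>x. (cmod (f x))\<^sup>2 \<partial>M)"
proof -
  have "(\<integral>x. (cmod (rep (L2_class M f) x))\<^sup>2 \<partial>M) = (\<integral>x. (cmod (f x))\<^sup>2 \<partial>M)"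
  proof (rule integral_cong_AE)
    show "AE x in M. (cmod (rep (L2_class M f) x))\<^sup>2 = (cmod (f x))\<^sup>2"
      using AE_rep_class[OF assms(1)] by eventually_elim simp
  qed (use assms in \<open>auto intro!: borel_measurable_integrable sq_integrable_norm\<close>)
  then show ?thesis
    by (simp add: L2_norm_def)
qed

section \<open>Inner product and norm on classes\<close>

lemma L2_add_in [simp, intro]: "u \<in> L2 M \<Longrightarrow> w \<in> L2 M \<Longrightarrow> L2_add M u w \<in> L2 M"
  and L2_diff_in [simp, intro]: "u \<in> L2 M \<Longrightarrow> w \<in> L2 M \<Longrightarrow> L2_diff M u w \<in> L2 M"
  and L2_scale_in [simp, intro]: "u \<in> L2 M \<Longrightarrow> L2_scale M c u \<in> L2 M"
  by (auto elim!: L2E)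

lemma L2_sum_in [intro]:
  assumes "finite D" "\<And>d. d \<in> D \<Longrightarrow> w d \<in> L2 M"
  shows "L2_sum M w D \<in> L2 M"
  using assms by (subst L2_sum_class[where f = "\<lambda>d. rep (w d)"])
    (auto simp: L2_class_rep sq_integrable_rep)

lemma L2_inner_diff_left:
  "\<lbrakk>u \<in> L2 M; w \<in> L2 M; t \<in> L2 M\<rbrakk> \<Longrightarrow>
    L2_inner M (L2_diff M u w) t = L2_inner M u t - L2_inner M w t"
  by (auto elim!: L2E simp: integrable_mult_cnj left_diff_distrib)

lemma L2_inner_add_left:
  "\<lbrakk>u \<in> L2 M; w \<in> L2 M; t \<in> L2 M\<rbrakk> \<Longrightarrow>
    L2_inner M (L2_add M u w) t = L2_inner M u t + L2_inner M w t"
  by (auto elim!: L2E simp: integrable_mult_cnj distrib_right)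

lemma L2_inner_scale_left:
  "\<lbrakk>u \<in> L2 M; t \<in> L2 M\<rbrakk> \<Longrightarrow> L2_inner M (L2_scale M c u) t = c * L2_inner M u t"
  by (auto elim!: L2E simp: integrable_mult_cnj mult.assoc)

lemma L2_inner_commute:
  assumes "u \<in> L2 M" "w \<in> L2 M"
  shows "L2_inner M w u = cnj (L2_inner M u w)"
  using assms by (auto elim!: L2E simp: mult.commute simp flip: Bochner_Integration.integral_cnj)

lemma L2_inner_self:
  assumes "u \<in> L2 M"
  shows "L2_inner M u u = of_real ((L2_norm M u)\<^sup>2)"
  using assms by (auto elim!: L2E simp: complex_norm_square[symmetric] simp del: of_real_power
      simp flip: integral_complex_of_real)

lemma L2_norm_nonneg: "u \<in> L2 M \<Longrightarrow> 0 \<le> L2_norm M u"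
  by (auto elim!: L2E)

lemma L2_eqI_norm:
  assumes "u \<in> L2 M" "w \<in> L2 M" "L2_inner M (L2_diff M u w) (L2_diff M u w) = 0"
  shows "u = w"
proof -
  obtain f g where f: "f \<in> sq_integrable M" "u = L2_class M f"
    and g: "g \<in> sq_integrable M" "w = L2_class M g"
    using assms by (metis L2E)
  have "(\<integral>x. (cmod (f x - g x))\<^sup>2 \<partial>M) = 0"
    using assms(3) f g unfolding L2_inner_self[OF L2_diff_in[OF assms(1,2)]] by simp
  then have "AE x in M. (cmod (f x - g x))\<^sup>2 = 0"
    using f g by (subst (asm) integral_nonneg_eq_0_iff_AE) (auto simp: sq_integrable_norm)
  then have "AE x in M. f x = g x"
    by eventually_elim simp
  then show ?thesis
    using f g by (simp add: L2_class_eq_iff)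
qed

text \<open>Testing with the difference of \<open>u\<close> and \<open>w\<close> reduces this to
  definiteness. It serves for maps known only through inner products, such as an adjoint.\<close>

lemma L2_eqI_inner:
  assumes "u \<in> L2 M" "w \<in> L2 M" "\<And>t. t \<in> L2 M \<Longrightarrow> L2_inner M u t = L2_inner M w t"
  shows "u = w"
  using assms by (intro L2_eqI_norm) (auto simp: L2_inner_diff_left)

lemma L2_norm_diff_le:
  assumes "u \<in> L2 M" "w \<in> L2 M"
  shows "L2_norm M (L2_diff M u w) \<le> 2 * (L2_norm M u + L2_norm M w)"
proof -
  obtain f g where f: "f \<in> sq_integrable M" "u = L2_class M f"
    and g: "g \<in> sq_integrable M" "w = L2_class M g"
    using assms by (metis L2E)
  have "(L2_norm M (L2_diff M u w))\<^sup>2 = (\<integral>x. (cmod (f x - g x))\<^sup>2 \<partial>M)"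
    using f g by simp
  also have "\<dots> \<le> (\<integral>x. 2 * (cmod (f x))\<^sup>2 + 2 * (cmod (g x))\<^sup>2 \<partial>M)"
  proof (rule integral_mono)
    show "(cmod (f x - g x))\<^sup>2 \<le> 2 * (cmod (f x))\<^sup>2 + 2 * (cmod (g x))\<^sup>2" for x
      using norm_add_power2_le[of "f x" "- g x"] by simp
  qed (use f g in \<open>auto simp: sq_integrable_norm\<close>)
  also have "\<dots> = 2 * (L2_norm M u)\<^sup>2 + 2 * (L2_norm M w)\<^sup>2"
    using f g by (simp add: sq_integrable_norm)
  also have "\<dots> \<le> (2 * (L2_norm M u + L2_norm M w))\<^sup>2"
    using L2_norm_nonneg[OF assms(1)] L2_norm_nonneg[OF assms(2)]
    by (simp add: power2_eq_square algebra_simps)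
  finally show ?thesis
    by (rule power2_le_imp_le) (simp add: L2_norm_nonneg assms)
qed

lemma L2_norm_scale: "u \<in> L2 M \<Longrightarrow> L2_norm M (L2_scale M c u) = cmod c * L2_norm M u"
  by (auto elim!: L2E simp: norm_mult power_mult_distrib real_sqrt_mult)

section \<open>Orthogonal projections\<close>

text \<open>A function is measurable for this \<open>\<sigma>\<close>-algebra iff it is measurable and constant along \<open>R\<close>, so
  conditional expectations given it provide the projections.\<close>

definition invariant_algebra :: "'x measure \<Rightarrow> ('x \<Rightarrow> 'x \<Rightarrow> bool) \<Rightarrow> 'x measure" where
  "invariant_algebra M R = sigma (space M)
     {A \<in> sets M. \<forall>x\<in>space M. \<forall>y\<in>space M. R x y \<longrightarrow> (x \<in> A \<longleftrightarrow> y \<in> A)}"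

lemma space_invariant_algebra [simp]: "space (invariant_algebra M R) = space M"
  unfolding invariant_algebra_def using sets.sets_into_space by (intro space_measure_of) blast

text \<open>The generating family is already a \<sigma>-algebra: invariance along \<open>R\<close>
  passes to complements and countable unions.\<close>

lemma sets_invariant_algebra:
  "sets (invariant_algebra M R) =
     {A \<in> sets M. \<forall>x\<in>space M. \<forall>y\<in>space M. R x y \<longrightarrow> (x \<in> A \<longleftrightarrow> y \<in> A)}" (is "_ = ?S")
proof -
  have "sigma_algebra (space M) ?S"
    unfolding sigma_algebra_iff2
  proof (intro conjI ballI allI impI)
    show "?S \<subseteq> Pow (space M)"
      using sets.sets_into_space by blast
    show "(\<Union>i. A i) \<in> ?S" if "range A \<subseteq> ?S" for A :: "nat \<Rightarrow> 'a set"
    proof -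
      have A: "A i \<in> ?S" for i
        using that by blast
      then have "(\<Union>i. A i) \<in> sets M"
        by (intro sets.countable_UN) blast
      moreover have "x \<in> A i \<longleftrightarrow> y \<in> A i" if "x \<in> space M" "y \<in> space M" "R x y" for x y i
        using A[of i] that by blast
      ultimately show ?thesis
        by simp
    qed
  qed auto
  then show ?thesis
    unfolding invariant_algebra_def by (rule sigma_algebra.sets_measure_of_eq)
qed

lemma subalgebra_invariant_algebra: "subalgebra M (invariant_algebra M R)"
  by (auto simp: subalgebra_def sets_invariant_algebra)

lemma borel_measurable_invariant_algebra_iff:
  fixes f :: "'x \<Rightarrow> 'v::t1_space"
  shows "f \<in> borel_measurable (invariant_algebra M R) \<longleftrightarrow>
    f \<in> borel_measurable M \<and> (\<forall>x\<in>space M. \<forall>y\<in>space M. R x y \<longrightarrow> f x = f y)"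
proof safe
  assume f: "f \<in> borel_measurable (invariant_algebra M R)"
  then show "f \<in> borel_measurable M"
    by (rule measurable_from_subalg[OF subalgebra_invariant_algebra])
  fix x y assume xy: "x \<in> space M" "y \<in> space M" "R x y"
  \<comment> \<open>Singletons are closed in a T1 space, so the level set of \<open>f\<close>
    through \<open>y\<close> is measurable and hence invariant along \<open>R\<close>.\<close>
  have "f -` {f y} \<inter> space M \<in> sets (invariant_algebra M R)"
    using measurable_sets[OF f, of "{f y}"] by simp
  then have "x \<in> f -` {f y} \<inter> space M \<longleftrightarrow> y \<in> f -` {f y} \<inter> space M"
    using xy unfolding sets_invariant_algebra by blast
  then show "f x = f y"
    using xy by auto
next
  assume f: "f \<in> borel_measurable M" "\<forall>x\<in>space M. \<forall>y\<in>space M. R x y \<longrightarrow> f x = f y"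
  show "f \<in> borel_measurable (invariant_algebra M R)"
    unfolding measurable_def using f by (auto simp: sets_invariant_algebra measurable_sets)
qed

section \<open>Projections from conditional expectations\<close>

lemma (in prob_space) real_projection_exists:
  fixes f :: "'a \<Rightarrow> real"
  assumes sub: "subalgebra M G" and f: "f \<in> borel_measurable M" "integrable M (\<lambda>x. (f x)\<^sup>2)"
  obtains p where "p \<in> borel_measurable G" "integrable M (\<lambda>x. (p x)\<^sup>2)"
    "\<And>t. \<lbrakk>t \<in> borel_measurable G; integrable M (\<lambda>x. (t x)\<^sup>2)\<rbrakk> \<Longrightarrow>
       integrable M (\<lambda>x. (f x - p x) * t x) \<and> (\<integral>x. (f x - p x) * t x \<partial>M) = 0"
proof
  interpret finite_measure_subalgebra M G
    by unfold_locales (rule sub)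
  let ?p = "real_cond_exp M G f"
  note f(1) [measurable]
  have "integrable M f"
    using square_integrable_imp_integrable[OF f] .
  \<comment> \<open>Jensen's inequality for the square.\<close>
  then show "integrable M (\<lambda>x. (?p x)\<^sup>2)"
    using f convex_power2 by (intro integrable_convex_cond_exp[where I = UNIV]) auto
  show "?p \<in> borel_measurable G"
    by simp
  fix t :: "'a \<Rightarrow> real"
  assume t: "t \<in> borel_measurable G" "integrable M (\<lambda>x. (t x)\<^sup>2)"
  have [measurable]: "t \<in> borel_measurable M"
    using sub t(1) by (rule measurable_from_subalg)
  have ft: "integrable M (\<lambda>x. t x * f x)"
  proof (rule Bochner_Integration.integrable_bound[where f = "\<lambda>x. (f x)\<^sup>2 + (t x)\<^sup>2"])
    have "\<bar>t x\<bar> * \<bar>f x\<bar> \<le> (f x)\<^sup>2 + (t x)\<^sup>2" for x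
      using sum_squares_bound[of "\<bar>t x\<bar>" "\<bar>f x\<bar>"] zero_le_power2[of "f x"] zero_le_power2[of "t x"]
      unfolding power2_abs by linarith
    then show "AE x in M. norm (t x * f x) \<le> norm ((f x)\<^sup>2 + (t x)\<^sup>2)"
      by (simp add: abs_mult)
  qed (use t f in auto)
  \<comment> \<open>A \<open>G\<close>-measurable factor \<open>t\<close> may be pulled out of the
    conditional expectation, so \<open>t * f\<close> and \<open>t * ?p\<close> have the same
    integral.\<close>
  show "integrable M (\<lambda>x. (f x - ?p x) * t x) \<and> (\<integral>x. (f x - ?p x) * t x \<partial>M) = 0"
    using real_cond_exp_intg[OF ft t(1) f(1)] ft
    by (simp add: mult.commute[of "f x - y" "t x" for x y] right_diff_distrib)
qed

text \<open>Real and imaginary parts are projected separately and reassembled, with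
  \<open>invariant_algebra M R\<close> as the subalgebra.\<close>

lemma (in prob_space) projection_exists:
  assumes f: "f \<in> sq_integrable M"
  obtains p where "p \<in> sq_integrable M"
    "\<forall>x\<in>space M. \<forall>y\<in>space M. R x y \<longrightarrow> p x = p y"
    "\<And>t. \<lbrakk>t \<in> sq_integrable M; \<forall>x\<in>space M. \<forall>y\<in>space M. R x y \<longrightarrow> t x = t y\<rbrakk> \<Longrightarrow>
       (\<integral>x. (f x - p x) * cnj (t x) \<partial>M) = 0"
proof -
  let ?G = "invariant_algebra M R"
  note sub = subalgebra_invariant_algebra[of M R]
  have parts: "integrable M (\<lambda>x. (Re (h x))\<^sup>2)" "integrable M (\<lambda>x. (Im (h x))\<^sup>2)"
    if "h \<in> sq_integrable M" for h
  proof -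
    have [measurable]: "h \<in> borel_measurable M"
      using that by (rule sq_integrable_measurable)
    show "integrable M (\<lambda>x. (Re (h x))\<^sup>2)" "integrable M (\<lambda>x. (Im (h x))\<^sup>2)"
      by (rule Bochner_Integration.integrable_bound[OF sq_integrable_norm[OF that]];
          simp add: cmod_power2)+
  qed
  have [measurable]: "f \<in> borel_measurable M"
    using f by (rule sq_integrable_measurable)
  obtain p1 where p1: "p1 \<in> borel_measurable ?G" "integrable M (\<lambda>x. (p1 x)\<^sup>2)"
    and orth1: "\<And>t. \<lbrakk>t \<in> borel_measurable ?G; integrable M (\<lambda>x. (t x)\<^sup>2)\<rbrakk> \<Longrightarrow>
       integrable M (\<lambda>x. (Re (f x) - p1 x) * t x) \<and> (\<integral>x. (Re (f x) - p1 x) * t x \<partial>M) = 0"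
    using real_projection_exists[OF sub _ parts(1)[OF f]] by auto
  obtain p2 where p2: "p2 \<in> borel_measurable ?G" "integrable M (\<lambda>x. (p2 x)\<^sup>2)"
    and orth2: "\<And>t. \<lbrakk>t \<in> borel_measurable ?G; integrable M (\<lambda>x. (t x)\<^sup>2)\<rbrakk> \<Longrightarrow>
       integrable M (\<lambda>x. (Im (f x) - p2 x) * t x) \<and> (\<integral>x. (Im (f x) - p2 x) * t x \<partial>M) = 0"
    using real_projection_exists[OF sub _ parts(2)[OF f]] by auto
  define p where "p = (\<lambda>x. Complex (p1 x) (p2 x))"
  have pG: "p \<in> borel_measurable ?G"
    using p1 p2 by (simp add: borel_measurable_complex_iff p_def)
  have p: "p \<in> sq_integrable M"
    using p1 p2 pG
    by (auto intro!: sq_integrableI simp: borel_measurable_invariant_algebra_iff cmod_power2 p_def)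
  show thesis
  proof
    show "p \<in> sq_integrable M" "\<forall>x\<in>space M. \<forall>y\<in>space M. R x y \<longrightarrow> p x = p y"
      using p pG by (auto simp: borel_measurable_invariant_algebra_iff)
    fix t assume t: "t \<in> sq_integrable M" "\<forall>x\<in>space M. \<forall>y\<in>space M. R x y \<longrightarrow> t x = t y"
    then have "t \<in> borel_measurable ?G"
      by (auto simp: borel_measurable_invariant_algebra_iff sq_integrable_measurable)
    then have tG: "(\<lambda>x. Re (t x)) \<in> borel_measurable ?G" "(\<lambda>x. Im (t x)) \<in> borel_measurable ?G"
      by (simp_all add: borel_measurable_complex_iff)
    \<comment> \<open>Four real relations: each part of \<open>f - p\<close> against each part of
      \<open>t\<close>. They combine to the real and imaginary parts of the complex
      integral.\<close>
    note orth = orth1[OF tG(1) parts(1)[OF t(1)]] orth1[OF tG(2) parts(2)[OF t(1)]]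
      orth2[OF tG(1) parts(1)[OF t(1)]] orth2[OF tG(2) parts(2)[OF t(1)]]
    have int: "integrable M (\<lambda>x. (f x - p x) * cnj (t x))"
      using f p t by (intro integrable_mult_cnj) auto
    show "(\<integral>x. (f x - p x) * cnj (t x) \<partial>M) = 0"
    proof (rule complex_eqI)
      have "(\<integral>x. Re ((f x - p x) * cnj (t x)) \<partial>M) =
          (\<integral>x. (Re (f x) - p1 x) * Re (t x) + (Im (f x) - p2 x) * Im (t x) \<partial>M)"
        by (simp add: p_def)
      also have "\<dots> = 0"
        using orth by simp
      finally show "Re (\<integral>x. (f x - p x) * cnj (t x) \<partial>M) = Re 0"
        using integral_Re[OF int] by simp
      have "(\<integral>x. Im ((f x - p x) * cnj (t x)) \<partial>M) =
          (\<integral>x. (Im (f x) - p2 x) * Re (t x) - (Re (f x) - p1 x) * Im (t x) \<partial>M)"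
        by (simp add: p_def)
      also have "\<dots> = 0"
        using orth by simp
      finally show "Im (\<integral>x. (f x - p x) * cnj (t x) \<partial>M) = Im 0"
        using integral_Im[OF int] by simp
    qed
  qed
qed

section \<open>Projections onto subspaces of classes\<close>

text \<open>Two candidates differ by an element of \<open>S\<close> that is orthogonal to
  \<open>S\<close>, hence to itself. So \<open>p\<close> is the only candidate and the definite
  description returns it.\<close>

lemma L2_proj_eqI:
  assumes S: "S \<subseteq> L2 M" "\<And>v w. \<lbrakk>v \<in> S; w \<in> S\<rbrakk> \<Longrightarrow> L2_diff M v w \<in> S"
    and u: "u \<in> L2 M" and p: "p \<in> S" "\<And>t. t \<in> S \<Longrightarrow> L2_inner M (L2_diff M u p) t = 0"
  shows "L2_proj M S u = p"
  unfolding L2_proj_def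
proof (rule the_equality)
  show "p \<in> S \<and> (\<forall>s\<in>S. L2_inner M (L2_diff M u p) s = 0)"
    using p by blast
next
  fix q assume q: "q \<in> S \<and> (\<forall>s\<in>S. L2_inner M (L2_diff M u q) s = 0)"
  let ?d = "L2_diff M q p"
  have in_L2: "q \<in> L2 M" "p \<in> L2 M" and d: "?d \<in> S" "?d \<in> L2 M"
    using S p q by blast+
  have "L2_inner M (L2_diff M u p) ?d = 0" "L2_inner M (L2_diff M u q) ?d = 0"
    using p(2) q d(1) by blast+
  then have "L2_inner M ?d ?d = 0"
    using u in_L2 d(2) by (simp add: L2_inner_diff_left)
  with in_L2 show "q = p"
    by (rule L2_eqI_norm)
qed

lemma coord_constI:
  assumes "f \<in> sq_integrable M"
    and "\<And>x y. \<lbrakk>x \<in> space M; y \<in> space M; \<And>i. i \<notin> L \<Longrightarrow> x i = y i\<rbrakk> \<Longrightarrow> f x = f y"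
  shows "L2_class M f \<in> coord_const M L"
  unfolding coord_const_def mem_Collect_eq
  by (intro exI[of _ f] conjI refl assms(1) ballI impI) (rule assms(2), blast+)

lemma coord_constE:
  assumes "u \<in> coord_const M L"
  obtains f where "f \<in> sq_integrable M" "u = L2_class M f"
    "\<forall>x\<in>space M. \<forall>y\<in>space M. (\<forall>i. i \<notin> L \<longrightarrow> x i = y i) \<longrightarrow> f x = f y"
  using assms unfolding coord_const_def mem_Collect_eq by (elim exE conjE) (rule that)

lemma coord_const_subset: "coord_const M L \<subseteq> L2 M"
  by (auto simp: coord_const_def)

lemma coord_const_diff:
  assumes "v \<in> coord_const M L" "w \<in> coord_const M L"
  shows "L2_diff M v w \<in> coord_const M L"
proof -
  let ?c = "\<lambda>f. \<forall>x\<in>space M. \<forall>y\<in>space M. (\<forall>i. i \<notin> L \<longrightarrow> x i = y i) \<longrightarrow> f x = f y"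
  obtain f where f: "f \<in> sq_integrable M" "v = L2_class M f" and cf: "?c f"
    using assms(1) by (rule coord_constE)
  obtain g where g: "g \<in> sq_integrable M" "w = L2_class M g" and cg: "?c g"
    using assms(2) by (rule coord_constE)
  have "L2_class M (\<lambda>x. f x - g x) \<in> coord_const M L"
  proof (rule coord_constI)
    fix x y assume "x \<in> space M" "y \<in> space M" "\<And>i. i \<notin> L \<Longrightarrow> x i = y i"
    then have "f x = f y" "g x = g y"
      using cf cg by blast+
    then show "f x - g x = f y - g y"
      by simp
  qed (use f g in simp)
  then show ?thesis
    using f g by simp
qed

text \<open>Taking agreement outside \<open>L\<close> as the relation in
  \<open>projection_exists\<close> supplies the candidate, so \<open>L2_proj\<close> is meaningful
  on these spaces.\<close>

lemma
  assumes M: "prob_space M" and u: "u \<in> L2 M"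
  shows L2_proj_coord_const_in: "L2_proj M (coord_const M L) u \<in> coord_const M L"
    and L2_proj_coord_const_orthogonal: "t \<in> coord_const M L \<Longrightarrow>
      L2_inner M (L2_diff M u (L2_proj M (coord_const M L) u)) t = 0"
proof -
  obtain f where f: "f \<in> sq_integrable M" "u = L2_class M f"
    using u by (rule L2E)
  let ?R = "\<lambda>x y. \<forall>i. i \<notin> L \<longrightarrow> x i = y i"
  obtain p where p: "p \<in> sq_integrable M" "\<forall>x\<in>space M. \<forall>y\<in>space M. ?R x y \<longrightarrow> p x = p y"
    and orth: "\<And>t. \<lbrakk>t \<in> sq_integrable M; \<forall>x\<in>space M. \<forall>y\<in>space M. ?R x y \<longrightarrow> t x = t y\<rbrakk> \<Longrightarrow>
       (\<integral>x. (f x - p x) * cnj (t x) \<partial>M) = 0"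
    using prob_space.projection_exists[OF M f(1), where R = ?R] by blast
  have in_S: "L2_class M p \<in> coord_const M L"
    using p(1) by (rule coord_constI) (use p(2) in blast)
  have orth': "L2_inner M (L2_diff M u (L2_class M p)) t = 0" if t: "t \<in> coord_const M L" for t
  proof -
    obtain h where h: "h \<in> sq_integrable M" "t = L2_class M h"
      and const: "\<forall>x\<in>space M. \<forall>y\<in>space M. ?R x y \<longrightarrow> h x = h y"
      using t by (rule coord_constE)
    from h(1) const have "(\<integral>x. (f x - p x) * cnj (h x) \<partial>M) = 0"
      by (rule orth)
    then show ?thesis
      using f(1) p(1) h(1) by (simp add: f(2) h(2))
  qed
  have "L2_proj M (coord_const M L) u = L2_class M p"
    by (rule L2_proj_eqI[OF coord_const_subset coord_const_diff u in_S orth'])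
  then show "L2_proj M (coord_const M L) u \<in> coord_const M L"
    and "t \<in> coord_const M L \<Longrightarrow>
      L2_inner M (L2_diff M u (L2_proj M (coord_const M L) u)) t = 0"
    using in_S orth' by simp_all
qed

lemma L2_proj_coord_const_in_L2:
  "\<lbrakk>prob_space M; u \<in> L2 M\<rbrakk> \<Longrightarrow> L2_proj M (coord_const M L) u \<in> L2 M"
  using L2_proj_coord_const_in coord_const_subset by blast

text \<open>Constants lie in every space \<open>coord_const M L\<close>. Hence products and convex
  combinations of these projections fix constants, as the mean does; this later puts 0 into the
  spectra.\<close>

lemma L2_proj_coord_const_const:
  assumes "prob_space M"
  shows "L2_proj M (coord_const M L) (L2_class M (\<lambda>_. c)) = L2_class M (\<lambda>_. c)"
proof (rule L2_proj_eqI[OF coord_const_subset coord_const_diff])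
  interpret prob_space M
    by fact
  show "L2_class M (\<lambda>_. c) \<in> coord_const M L"
    by (rule coord_constI) simp_all
  show "L2_inner M (L2_diff M (L2_class M (\<lambda>_. c)) (L2_class M (\<lambda>_. c))) t = 0"
    if "t \<in> coord_const M L" for t
    using that by (auto simp: coord_const_def)
  show "L2_class M (\<lambda>_. c) \<in> L2 M"
    by simp
qed

section \<open>Bounded linear maps between two spaces\<close>

definition L2_bounded_linear_between ::
    "'x measure \<Rightarrow> 'y measure \<Rightarrow> ('x fclass \<Rightarrow> 'y fclass) \<Rightarrow> bool" where
  "L2_bounded_linear_between M N T \<longleftrightarrow>
     (\<forall>u\<in>L2 M. T u \<in> L2 N) \<and>
     (\<forall>u\<in>L2 M. \<forall>w\<in>L2 M. T (L2_add M u w) = L2_add N (T u) (T w)) \<and>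
     (\<forall>c. \<forall>u\<in>L2 M. T (L2_scale M c u) = L2_scale N c (T u)) \<and>
     (\<exists>C. \<forall>u\<in>L2 M. L2_norm N (T u) \<le> C * L2_norm M u)"

lemma L2_bounded_linear_between_self:
  "L2_bounded_linear_between M M T \<longleftrightarrow> L2_bounded_linear M T"
  by (simp add: L2_bounded_linear_between_def L2_bounded_linear_def)

lemma
  assumes "L2_bounded_linear_between M N T"
  shows L2_bounded_linear_between_in: "u \<in> L2 M \<Longrightarrow> T u \<in> L2 N"
    and L2_bounded_linear_between_add:
      "\<lbrakk>u \<in> L2 M; w \<in> L2 M\<rbrakk> \<Longrightarrow> T (L2_add M u w) = L2_add N (T u) (T w)"
    and L2_bounded_linear_between_scale:
      "u \<in> L2 M \<Longrightarrow> T (L2_scale M c u) = L2_scale N c (T u)"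
  using assms by (auto simp: L2_bounded_linear_between_def)

lemma L2_bounded_linear_between_zero:
  assumes T: "L2_bounded_linear_between M N T"
  shows "T (L2_class M (\<lambda>_. 0)) = L2_class N (\<lambda>_. 0)"
proof -
  have "T (L2_class M (\<lambda>_. 0)) = L2_scale N 0 (T (L2_class M (\<lambda>_. 0)))"
    using L2_bounded_linear_between_scale[OF T, of "L2_class M (\<lambda>_. 0)" 0] by simp
  also have "\<dots> = L2_class N (\<lambda>_. 0)"
    using L2_bounded_linear_between_in[OF T L2_class_in_L2[OF sq_integrable_zero]]
    by (rule L2E) simp
  finally show ?thesis .
qed

lemma L2_bounded_linear_between_bound:
  assumes "L2_bounded_linear_between M N T"
  obtains C where "C \<ge> 0" "\<And>u. u \<in> L2 M \<Longrightarrow> L2_norm N (T u) \<le> C * L2_norm M u"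
proof -
  obtain C where C: "\<And>u. u \<in> L2 M \<Longrightarrow> L2_norm N (T u) \<le> C * L2_norm M u"
    using assms unfolding L2_bounded_linear_between_def by blast
  \<comment> \<open>The constant \<open>C\<close> might be negative. A nonnegative one can be
    multiplied into other bounds.\<close>
  have "L2_norm N (T u) \<le> \<bar>C\<bar> * L2_norm M u" if "u \<in> L2 M" for u
    using C[OF that] L2_norm_nonneg[OF that] by (meson abs_ge_self mult_right_mono order_trans)
  then show thesis
    by (intro that[of "\<bar>C\<bar>"]) auto
qed

lemma L2_diff_conv_add:
  "\<lbrakk>u \<in> L2 M; w \<in> L2 M\<rbrakk> \<Longrightarrow> L2_diff M u w = L2_add M u (L2_scale M (-1) w)"
  by (auto elim!: L2E)

lemma L2_bounded_linear_between_diff: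
  assumes "L2_bounded_linear_between M N T" "u \<in> L2 M" "w \<in> L2 M"
  shows "T (L2_diff M u w) = L2_diff N (T u) (T w)"
  using assms(2,3) L2_bounded_linear_between_in[OF assms(1)]
  by (simp add: L2_diff_conv_add L2_bounded_linear_between_add[OF assms(1)]
      L2_bounded_linear_between_scale[OF assms(1)])

lemma L2_bounded_linear_between_comp:
  assumes "L2_bounded_linear_between M N T" "L2_bounded_linear_between N Q S"
  shows "L2_bounded_linear_between M Q (\<lambda>u. S (T u))"
proof -
  obtain C where C: "C \<ge> 0" "\<And>u. u \<in> L2 M \<Longrightarrow> L2_norm N (T u) \<le> C * L2_norm M u"
    using L2_bounded_linear_between_bound[OF assms(1)] by blast
  obtain D where D: "D \<ge> 0" "\<And>u. u \<in> L2 N \<Longrightarrow> L2_norm Q (S u) \<le> D * L2_norm N u"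
    using L2_bounded_linear_between_bound[OF assms(2)] by blast
  have "L2_norm Q (S (T u)) \<le> (D * C) * L2_norm M u" if "u \<in> L2 M" for u
    using D(2)[OF L2_bounded_linear_between_in[OF assms(1) that]]
      mult_left_mono[OF C(2)[OF that] D(1)] by (simp add: mult.assoc)
  then have "\<exists>E. \<forall>u\<in>L2 M. L2_norm Q (S (T u)) \<le> E * L2_norm M u"
    by blast
  then show ?thesis
    using assms unfolding L2_bounded_linear_between_def by simp
qed

lemma L2_bounded_linear_between_id: "L2_bounded_linear_between M M (\<lambda>u. u)"
  unfolding L2_bounded_linear_between_def by (auto intro!: exI[of _ 1])

lemma L2_bounded_linear_between_scale_op:
  assumes "L2_bounded_linear_between M N T"
  shows "L2_bounded_linear_between M N (\<lambda>u. L2_scale N c (T u))"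
proof (rule L2_bounded_linear_between_comp[OF assms])
  have "L2_scale N c (L2_add N u w) = L2_add N (L2_scale N c u) (L2_scale N c w)"
    if "u \<in> L2 N" "w \<in> L2 N" for u w
    using that by (auto elim!: L2E simp: distrib_left)
  moreover have "L2_scale N c (L2_scale N b u) = L2_scale N b (L2_scale N c u)"
    if "u \<in> L2 N" for u b
    using that by (auto elim!: L2E simp: mult.left_commute)
  ultimately show "L2_bounded_linear_between N N (L2_scale N c)"
    unfolding L2_bounded_linear_between_def by (auto simp: L2_norm_scale)
qed

lemma L2_bounded_linear_between_diff_op:
  assumes T: "L2_bounded_linear_between M N T" and S: "L2_bounded_linear_between M N S"
  shows "L2_bounded_linear_between M N (\<lambda>u. L2_diff N (T u) (S u))"
proof -
  obtain C where C: "C \<ge> 0" "\<And>u. u \<in> L2 M \<Longrightarrow> L2_norm N (T u) \<le> C * L2_norm M u"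
    using L2_bounded_linear_between_bound[OF assms(1)] by blast
  obtain D where D: "D \<ge> 0" "\<And>u. u \<in> L2 M \<Longrightarrow> L2_norm N (S u) \<le> D * L2_norm M u"
    using L2_bounded_linear_between_bound[OF assms(2)] by blast
  have "L2_norm N (L2_diff N (T u) (S u)) \<le> (2 * (C + D)) * L2_norm M u" if "u \<in> L2 M" for u
    using L2_norm_diff_le[OF L2_bounded_linear_between_in[OF T that]
        L2_bounded_linear_between_in[OF S that]] C(2)[OF that] D(2)[OF that]
    by (simp add: algebra_simps)
  then have "\<exists>E. \<forall>u\<in>L2 M. L2_norm N (L2_diff N (T u) (S u)) \<le> E * L2_norm M u"
    by blast
  moreover have "L2_diff N (L2_add N a b) (L2_add N c d) = L2_add N (L2_diff N a c) (L2_diff N b d)"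
    if "a \<in> L2 N" "b \<in> L2 N" "c \<in> L2 N" "d \<in> L2 N" for a b c d
    using that by (auto elim!: L2E simp: algebra_simps)
  moreover have "L2_diff N (L2_scale N c a) (L2_scale N c b) = L2_scale N c (L2_diff N a b)"
    if "a \<in> L2 N" "b \<in> L2 N" for a b c
    using that by (auto elim!: L2E simp: algebra_simps)
  ultimately show ?thesis
    using assms unfolding L2_bounded_linear_between_def by simp
qed

lemma L2_bounded_linear_between_sum:
  assumes T: "L2_bounded_linear_between M N T" and "finite D" "\<And>d. d \<in> D \<Longrightarrow> w d \<in> L2 M"
  shows "T (L2_sum M w D) = L2_sum N (\<lambda>d. T (w d)) D"
  using assms(2,3)
proof (induction D)
  case empty
  then show ?case
    using L2_bounded_linear_between_zero[OF T] by (simp add: L2_sum_def)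
next
  case (insert a D)
  \<comment> \<open>Stated for an arbitrary measure, because the sum is split over \<open>M\<close>
    before \<open>T\<close> is applied and over \<open>N\<close> afterwards.\<close>
  have *: "L2_sum Q v (insert a D) = L2_add Q (v a) (L2_sum Q v D)"
    if "\<And>d. d \<in> insert a D \<Longrightarrow> v d \<in> L2 Q" for Q :: "'z measure" and v
  proof -
    have "(\<lambda>x. \<Sum>d\<in>D. rep (v d) x) \<in> sq_integrable Q" "rep (v a) \<in> sq_integrable Q"
      using that by (auto simp: sq_integrable_rep)
    then have "L2_add Q (L2_class Q (rep (v a))) (L2_sum Q v D) = L2_sum Q v (insert a D)"
      using insert.hyps by (simp add: L2_sum_def)
    then show ?thesis
      using that by (simp add: L2_class_rep)
  qed
  have "T (L2_sum M w (insert a D)) = L2_add N (T (w a)) (T (L2_sum M w D))"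
    using insert by (subst *) (auto simp: L2_bounded_linear_between_add[OF T] L2_sum_in)
  also have "\<dots> = L2_sum N (\<lambda>d. T (w d)) (insert a D)"
    using insert L2_bounded_linear_between_in[OF T] by (subst *) auto
  finally show ?case .
qed

section \<open>Comparison of spectra\<close>

text \<open>An inverse of \<open>T\<close> would have to send the zero class to \<open>e\<close>,
  whereas linearity makes it send zero to zero.\<close>

lemma L2_spectrum_zeroI:
  assumes e: "e \<in> L2 M" "e \<noteq> L2_class M (\<lambda>_. 0)" "T e = L2_class M (\<lambda>_. 0)"
  shows "0 \<in> L2_spectrum M T"
proof -
  have "L2_diff M (T e) (L2_scale M 0 e) = L2_class M (\<lambda>_. 0)"
    using e(1) by (auto elim!: L2E simp: e(3))
  moreover have "S (L2_class M (\<lambda>_. 0)) = L2_class M (\<lambda>_. 0)" if "L2_bounded_linear M S" for S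
    using that L2_bounded_linear_between_zero by (metis L2_bounded_linear_between_self)
  ultimately show ?thesis
    using e unfolding L2_spectrum_def by fastforce
qed

text \<open>On the range of \<open>\<iota>\<close> the operator \<open>T\<close> is a copy of \<open>A\<close>, and on the complementary kernel of
  \<open>\<kappa>\<close> it vanishes. So the spectra can only differ in \<open>0\<close>, which lies in both because \<open>A\<close> is not
  injective.\<close>

lemma L2_spectrum_retract:
  assumes \<iota>: "L2_bounded_linear_between N M \<iota>" and \<kappa>: "L2_bounded_linear_between M N \<kappa>"
    and \<kappa>\<iota>: "\<And>v. v \<in> L2 N \<Longrightarrow> \<kappa> (\<iota> v) = v"
    and A: "\<And>v. v \<in> L2 N \<Longrightarrow> A v \<in> L2 N"
    and T: "\<And>u. u \<in> L2 M \<Longrightarrow> T u = \<iota> (A (\<kappa> u))"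
    and e: "e \<in> L2 N" "e \<noteq> L2_class N (\<lambda>_. 0)" "A e = L2_class N (\<lambda>_. 0)"
  shows "L2_spectrum M T = L2_spectrum N A"
proof -
  note in_L2 [simp] = L2_bounded_linear_between_in[OF \<iota>] L2_bounded_linear_between_in[OF \<kappa>]
  note lin = L2_bounded_linear_between_diff[OF \<iota>] L2_bounded_linear_between_diff[OF \<kappa>]
    L2_bounded_linear_between_scale[OF \<iota>] L2_bounded_linear_between_scale[OF \<kappa>]
  have "\<iota> e \<noteq> L2_class M (\<lambda>_. 0)"
    using \<kappa>\<iota>[OF e(1)] e(2) L2_bounded_linear_between_zero[OF \<kappa>] by metis
  moreover have "T (\<iota> e) = L2_class M (\<lambda>_. 0)"
    using e by (simp add: T \<kappa>\<iota> L2_bounded_linear_between_zero[OF \<iota>])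
  ultimately have zero: "0 \<in> L2_spectrum M T" "0 \<in> L2_spectrum N A"
    using L2_spectrum_zeroI e in_L2(1) by blast+
  have nonzero: "c \<in> L2_spectrum M T \<longleftrightarrow> c \<in> L2_spectrum N A" if c: "c \<noteq> 0" for c
  proof -
    let ?RM = "\<exists>S. L2_bounded_linear M S \<and>
       (\<forall>u\<in>L2 M. S (L2_diff M (T u) (L2_scale M c u)) = u \<and>
                 L2_diff M (T (S u)) (L2_scale M c (S u)) = u)"
    let ?RN = "\<exists>S. L2_bounded_linear N S \<and>
       (\<forall>v\<in>L2 N. S (L2_diff N (A v) (L2_scale N c v)) = v \<and>
                 L2_diff N (A (S v)) (L2_scale N c (S v)) = v)"
    have M: ?RM
      if SI: "L2_bounded_linear N SI"
        and inv: "\<forall>v\<in>L2 N. SI (L2_diff N (A v) (L2_scale N c v)) = v \<and>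
                 L2_diff N (A (SI v)) (L2_scale N c (SI v)) = v" for SI
    proof (intro exI conjI ballI)
      \<comment> \<open>The inverse is assembled from two pieces: on the range of
        \<open>\<iota>\<close> it is the copy of \<open>SI\<close>, and on the kernel of
        \<open>\<kappa>\<close>, where \<open>T - c\<close> acts as \<open>- c\<close>, it is
        division by \<open>- c\<close>. The component of \<open>u\<close> in that kernel is
        \<open>u - \<iota> (\<kappa> u)\<close>.\<close>
      let ?S = "\<lambda>u. L2_diff M (\<iota> (SI (\<kappa> u))) (L2_scale M (1 / c) (L2_diff M u (\<iota> (\<kappa> u))))"
      have SI': "L2_bounded_linear_between N N SI"
        using SI by (simp add: L2_bounded_linear_between_self)
      note SI_in [simp] = L2_bounded_linear_between_in[OF SI']
      have "L2_bounded_linear_between M M ?S"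
        by (intro L2_bounded_linear_between_diff_op L2_bounded_linear_between_scale_op
            L2_bounded_linear_between_id L2_bounded_linear_between_comp[OF _ \<iota>]
            L2_bounded_linear_between_comp[OF _ SI'] \<kappa>)
      then show "L2_bounded_linear M ?S"
        by (simp add: L2_bounded_linear_between_self)
      fix u assume u: "u \<in> L2 M"
      let ?q = "\<iota> (\<kappa> u)" and ?w = "SI (\<kappa> u)"
      have "\<kappa> (L2_diff M (T u) (L2_scale M c u)) = L2_diff N (A (\<kappa> u)) (L2_scale N c (\<kappa> u))"
        using u by (simp add: lin T \<kappa>\<iota> A)
      moreover have "SI (L2_diff N (A (\<kappa> u)) (L2_scale N c (\<kappa> u))) = \<kappa> u"
        using inv u by simp
      moreover have "\<iota> (L2_diff N (A (\<kappa> u)) (L2_scale N c (\<kappa> u))) =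
          L2_diff M (\<iota> (A (\<kappa> u))) (L2_scale M c ?q)"
        using u by (simp add: lin A)
      \<comment> \<open>Here \<open>a\<close> stands for \<open>T u\<close> and \<open>q\<close> for
        \<open>\<iota> (\<kappa> u)\<close>: the inner difference is \<open>c * (q - u)\<close>, and
        subtracting \<open>q - u\<close> from \<open>q\<close> leaves \<open>u\<close>.\<close>
      moreover have "L2_diff M q (L2_scale M (1 / c)
          (L2_diff M (L2_diff M a (L2_scale M c u)) (L2_diff M a (L2_scale M c q)))) = u"
        if "a \<in> L2 M" "q \<in> L2 M" for a q
        using that u by (elim L2E) (simp, intro arg_cong[where f = "L2_class M"] ext, simp add: c field_simps)
      ultimately show "?S (L2_diff M (T u) (L2_scale M c u)) = u"
        using u by (simp add: T A)
      \<comment> \<open>The second piece of \<open>?S u\<close> lies in the kernel of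
        \<open>\<kappa>\<close>.\<close>
      have "\<kappa> (?S u) = ?w"
      proof -
        have "L2_diff N a (L2_scale N (1 / c) (L2_diff N b b)) = a" if "a \<in> L2 N" "b \<in> L2 N" for a b
          using that by (auto elim!: L2E)
        then show ?thesis
          using u by (simp add: lin \<kappa>\<iota>)
      qed
      then have "T (?S u) = \<iota> (A ?w)"
        using u by (subst T) auto
      moreover have "L2_diff M (\<iota> (A ?w)) (L2_scale M c (\<iota> ?w)) = ?q"
        using inv u by (simp add: A flip: lin)
      moreover have "L2_diff M b (L2_scale M c (L2_diff M z (L2_scale M (1 / c) (L2_diff M u q)))) =
          L2_add M (L2_diff M b (L2_scale M c z)) (L2_diff M u q)"
        if "b \<in> L2 M" "z \<in> L2 M" "q \<in> L2 M" for b z q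
        using that u by (elim L2E) (simp, intro arg_cong[where f = "L2_class M"] ext, simp add: c field_simps)
      moreover have "L2_add M q (L2_diff M u q) = u" if "q \<in> L2 M" for q
        using that u by (auto elim!: L2E)
      ultimately show "L2_diff M (T (?S u)) (L2_scale M c (?S u)) = u"
        using u by (simp add: A)
    qed
    have N: ?RN
      if S: "L2_bounded_linear M S"
        and inv: "\<forall>u\<in>L2 M. S (L2_diff M (T u) (L2_scale M c u)) = u \<and>
                 L2_diff M (T (S u)) (L2_scale M c (S u)) = u" for S
    proof (intro exI conjI ballI)
      \<comment> \<open>The compression of \<open>S\<close> inverts \<open>A - c\<close>, because
        both \<open>\<iota>\<close> and \<open>\<kappa>\<close> intertwine \<open>A - c\<close> with
        \<open>T - c\<close>.\<close>
      let ?SI = "\<lambda>v. \<kappa> (S (\<iota> v))"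
      have S': "L2_bounded_linear_between M M S"
        using S by (simp add: L2_bounded_linear_between_self)
      note S_in [simp] = L2_bounded_linear_between_in[OF S']
      have "L2_bounded_linear_between N N ?SI"
        by (intro L2_bounded_linear_between_comp[OF _ \<kappa>] L2_bounded_linear_between_comp[OF _ S'] \<iota>)
      then show "L2_bounded_linear N ?SI"
        by (simp add: L2_bounded_linear_between_self)
      fix v assume v: "v \<in> L2 N"
      have "\<iota> (L2_diff N (A v) (L2_scale N c v)) = L2_diff M (T (\<iota> v)) (L2_scale M c (\<iota> v))"
        using v by (simp add: lin T \<kappa>\<iota> A)
      then show "?SI (L2_diff N (A v) (L2_scale N c v)) = v"
        using inv v by (simp add: \<kappa>\<iota>)
      have "A (?SI v) = \<kappa> (T (S (\<iota> v)))"
        using v by (simp add: T \<kappa>\<iota> A)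
      then have "L2_diff N (A (?SI v)) (L2_scale N c (?SI v)) =
          \<kappa> (L2_diff M (T (S (\<iota> v))) (L2_scale M c (S (\<iota> v))))"
        using v by (simp add: lin T A)
      also have "\<dots> = v"
        using inv v by (simp add: \<kappa>\<iota>)
      finally show "L2_diff N (A (?SI v)) (L2_scale N c (?SI v)) = v" .
    qed
    have "?RM \<longleftrightarrow> ?RN"
      by (intro iffI; elim exE conjE) (erule (1) N, erule (1) M)
    then show ?thesis
      unfolding L2_spectrum_def mem_Collect_eq by (rule arg_cong)
  qed
  show ?thesis
  proof (rule set_eqI)
    fix c
    show "c \<in> L2_spectrum M T \<longleftrightarrow> c \<in> L2_spectrum N A"
      using zero nonzero[of c] by (cases "c = 0") simp_all
  qed
qed

section \<open>Pullback along a map with a measurable section\<close>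

text \<open>The map \<open>r\<close> carries the measure \<open>M\<close> to \<open>N\<close>. The
  section \<open>s\<close> turns functions constant on the fibres of \<open>r\<close> into
  measurable functions on \<open>N\<close>.\<close>

locale measure_retraction = prob_space M for M :: "'x measure" +
  fixes N :: "'y measure" and r :: "'x \<Rightarrow> 'y" and s :: "'y \<Rightarrow> 'x"
  assumes r [measurable]: "r \<in> measurable M N"
    and s [measurable]: "s \<in> measurable N M"
    and r_s: "\<And>y. y \<in> space N \<Longrightarrow> r (s y) = y"
    and distr_r: "distr M N r = N"
begin

lemma prob_space_N: "prob_space N"
  using prob_space_distr[OF r] by (simp add: distr_r)

lemma integral_pullback:
  fixes h :: "'y \<Rightarrow> complex"
  assumes "h \<in> borel_measurable N"
  shows "(\<integral>x. h (r x) \<partial>M) = (\<integral>y. h y \<partial>N)"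
  using integral_distr[OF r assms] by (simp add: distr_r)

lemma sq_integrable_pullback_iff:
  assumes [measurable]: "h \<in> borel_measurable N"
  shows "(\<lambda>x. h (r x)) \<in> sq_integrable M \<longleftrightarrow> h \<in> sq_integrable N"
  using integrable_distr_eq[OF r, of "\<lambda>y. (cmod (h y))\<^sup>2"] by (simp add: sq_integrable_def distr_r)

lemma sq_integrable_pullback [simp, intro]:
  "h \<in> sq_integrable N \<Longrightarrow> (\<lambda>x. h (r x)) \<in> sq_integrable M"
  using sq_integrable_pullback_iff sq_integrable_measurable by blast

definition pullback :: "'y fclass \<Rightarrow> 'x fclass" where
  "pullback v = L2_class M (\<lambda>x. rep v (r x))"

lemma pullback_class [simp]:
  assumes "h \<in> sq_integrable N"
  shows "pullback (L2_class N h) = L2_class M (\<lambda>x. h (r x))"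
proof -
  \<comment> \<open>With \<open>N\<close> written as an image measure, the exceptional null set
    pulls back to a null set of \<open>M\<close>.\<close>
  have "AE y in distr M N r. rep (L2_class N h) y = h y"
    unfolding distr_r using assms by (rule AE_rep_class)
  then have "AE x in M. rep (L2_class N h) (r x) = h (r x)"
    by (rule AE_distrD[OF r])
  then show ?thesis
    unfolding pullback_def using assms by (subst L2_class_eq_iff) auto
qed

lemma pullback_in [simp, intro]: "v \<in> L2 N \<Longrightarrow> pullback v \<in> L2 M"
  by (auto elim!: L2E)

lemma L2_inner_pullback:
  assumes "v \<in> L2 N" "w \<in> L2 N"
  shows "L2_inner M (pullback v) (pullback w) = L2_inner N v w"
proof -
  obtain f g where "f \<in> sq_integrable N" "v = L2_class N f" "g \<in> sq_integrable N" "w = L2_class N g"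
    using assms by (metis L2E)
  then show ?thesis
    using integral_pullback[of "\<lambda>y. f y * cnj (g y)"]
    by (simp add: borel_measurable_integrable integrable_mult_cnj)
qed

lemma L2_norm_pullback: "v \<in> L2 N \<Longrightarrow> L2_norm M (pullback v) = L2_norm N v"
  using L2_inner_pullback[of v v] L2_inner_self[of v N] L2_inner_self[of "pullback v" M]
    L2_norm_nonneg[of v N] L2_norm_nonneg[of "pullback v" M]
  by (metis of_real_eq_iff power2_eq_iff_nonneg pullback_in)

lemma pullback_linear: "L2_bounded_linear_between N M pullback"
  unfolding L2_bounded_linear_between_def
proof (intro conjI)
  show "\<exists>C. \<forall>v\<in>L2 N. L2_norm M (pullback v) \<le> C * L2_norm N v"
    by (intro exI[of _ 1]) (simp add: L2_norm_pullback)
qed (auto elim!: L2E)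

text \<open>The adjoint of the pullback: the projection onto the functions that are constant on the
  fibres of \<open>r\<close>, read on the image of the section \<open>s\<close>.\<close>

definition pushforward :: "'x fclass \<Rightarrow> 'y fclass" where
  "pushforward u = (SOME w. w \<in> L2 N \<and> (\<forall>t\<in>L2 N. L2_inner M u (pullback t) = L2_inner N w t))"

text \<open>The second assumption expresses constancy on the fibres of \<open>r\<close>. The
  pullback of \<open>f \<circ> s\<close> is then \<open>f\<close> itself, so integrability can be
  checked over \<open>M\<close>.\<close>

lemma sq_integrable_descend:
  assumes "f \<in> sq_integrable M" "\<And>x. x \<in> space M \<Longrightarrow> f (s (r x)) = f x"
  shows "(\<lambda>y. f (s y)) \<in> sq_integrable N"
proof -
  have [measurable]: "f \<in> borel_measurable M"
    using assms(1) by (rule sq_integrable_measurable)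
  have "integrable M (\<lambda>x. (cmod (f (s (r x))))\<^sup>2) \<longleftrightarrow> integrable M (\<lambda>x. (cmod (f x))\<^sup>2)"
    by (rule Bochner_Integration.integrable_cong) (simp_all add: assms(2))
  then have "(\<lambda>x. f (s (r x))) \<in> sq_integrable M"
    using sq_integrable_norm[OF assms(1)] by (intro sq_integrableI) simp_all
  then show ?thesis
    by (subst (asm) sq_integrable_pullback_iff[of "\<lambda>y. f (s y)"]) simp_all
qed

lemma pullback_descend:
  assumes "f \<in> sq_integrable M" "\<And>x. x \<in> space M \<Longrightarrow> f (s (r x)) = f x"
  shows "pullback (L2_class N (\<lambda>y. f (s y))) = L2_class M f"
  using assms sq_integrable_descend[OF assms]
  by (simp add: L2_class_eq_iff sq_integrable_pullback[of "\<lambda>y. f (s y)"])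

lemma
  assumes u: "u \<in> L2 M"
  shows pushforward_in [simp, intro]: "pushforward u \<in> L2 N"
    and L2_inner_pushforward:
      "t \<in> L2 N \<Longrightarrow> L2_inner M u (pullback t) = L2_inner N (pushforward u) t"
proof -
  obtain f where f: "f \<in> sq_integrable M" "u = L2_class M f"
    using u by (rule L2E)
  obtain p where p: "p \<in> sq_integrable M" "\<forall>x\<in>space M. \<forall>y\<in>space M. r x = r y \<longrightarrow> p x = p y"
    and orth: "\<And>t. \<lbrakk>t \<in> sq_integrable M; \<forall>x\<in>space M. \<forall>y\<in>space M. r x = r y \<longrightarrow> t x = t y\<rbrakk> \<Longrightarrow>
       (\<integral>x. (f x - p x) * cnj (t x) \<partial>M) = 0"
    using projection_exists[OF f(1), where R = "\<lambda>x y. r x = r y"] by blast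
  have rs: "r (s (r x)) = r x" "s (r x) \<in> space M" if "x \<in> space M" for x
    using that r_s measurable_space[OF r] measurable_space[OF s] by auto
  have p_s: "p (s (r x)) = p x" if "x \<in> space M" for x
    using p(2) rs[OF that] that by blast
  \<comment> \<open>The witness for \<open>pushforward u\<close>. Its pullback is the class of
    \<open>p\<close>, and every pullback is constant on fibres, hence orthogonal to
    \<open>f - p\<close>.\<close>
  define w where "w = L2_class N (\<lambda>y. p (s y))"
  have w: "w \<in> L2 N" "pullback w = L2_class M p"
    unfolding w_def using sq_integrable_descend[OF p(1) p_s] pullback_descend[OF p(1) p_s] by auto
  have "L2_inner M u (pullback t) = L2_inner N w t" if t: "t \<in> L2 N" for t
  proof -
    obtain h where h: "h \<in> sq_integrable N" "t = L2_class N h"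
      using t by (rule L2E)
    have "L2_inner M (L2_diff M u (pullback w)) (pullback t) = 0"
      using f(1) p(1) h(1) orth[of "\<lambda>x. h (r x)"] by (simp add: f(2) h(2) w(2))
    then show ?thesis
      using u w(1) t by (simp add: L2_inner_diff_left L2_inner_pullback)
  qed
  with w(1) have "w \<in> L2 N \<and> (\<forall>t\<in>L2 N. L2_inner M u (pullback t) = L2_inner N w t)"
    by blast
  then have *: "pushforward u \<in> L2 N \<and>
      (\<forall>t\<in>L2 N. L2_inner M u (pullback t) = L2_inner N (pushforward u) t)"
    unfolding pushforward_def by (rule someI)
  then show "pushforward u \<in> L2 N"
    and "t \<in> L2 N \<Longrightarrow> L2_inner M u (pullback t) = L2_inner N (pushforward u) t"
    by blast+
qed

text \<open>The adjoint of an isometry is a left inverse of it.\<close>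

lemma pushforward_pullback: "v \<in> L2 N \<Longrightarrow> pushforward (pullback v) = v"
  by (rule L2_eqI_inner) (auto simp: L2_inner_pullback simp flip: L2_inner_pushforward)

text \<open>Pythagoras: the pullback of \<open>pushforward u\<close> is the orthogonal projection of
  \<open>u\<close> onto the range of \<open>pullback\<close>, and it has the norm of
  \<open>pushforward u\<close>.\<close>

lemma L2_norm_pushforward_le:
  assumes u: "u \<in> L2 M"
  shows "L2_norm N (pushforward u) \<le> L2_norm M u"
proof -
  let ?w = "pushforward u" and ?p = "pullback (pushforward u)"
  have p: "?p \<in> L2 M" and w: "?w \<in> L2 N"
    using u by auto
  have up: "L2_inner M u ?p = L2_inner M ?p ?p"
    by (simp only: L2_inner_pushforward[OF u w] L2_inner_pullback[OF w w])
  \<comment> \<open>The value in \<open>up\<close> is real, so conjugation leaves it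
    unchanged.\<close>
  have sym: "L2_inner M ?p u = L2_inner M ?p ?p"
    using L2_inner_commute[OF u p] up L2_inner_self[OF p] by simp
  have "L2_inner M (L2_diff M u ?p) (L2_diff M u ?p) =
      cnj (L2_inner M (L2_diff M u ?p) u - L2_inner M (L2_diff M u ?p) ?p)"
    using u p L2_inner_commute[of u M "L2_diff M u ?p"] L2_inner_commute[of ?p M "L2_diff M u ?p"]
      L2_inner_commute[of "L2_diff M u ?p" M "L2_diff M u ?p"]
    by (simp add: L2_inner_diff_left)
  also have "\<dots> = cnj (L2_inner M u u - L2_inner M ?p ?p)"
    using u p up sym by (simp add: L2_inner_diff_left)
  finally have "complex_of_real ((L2_norm M (L2_diff M u ?p))\<^sup>2) =
      complex_of_real ((L2_norm M u)\<^sup>2 - (L2_norm M ?p)\<^sup>2)"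
    using u p by (simp add: L2_inner_self)
  then have "(L2_norm M (L2_diff M u ?p))\<^sup>2 = (L2_norm M u)\<^sup>2 - (L2_norm M ?p)\<^sup>2"
    unfolding of_real_eq_iff .
  then have "(L2_norm N ?w)\<^sup>2 \<le> (L2_norm M u)\<^sup>2"
    using w zero_le_power2[of "L2_norm M (L2_diff M u ?p)"] by (simp add: L2_norm_pullback)
  then show ?thesis
    using L2_norm_nonneg[OF u] by (rule power2_le_imp_le)
qed

lemma pushforward_linear: "L2_bounded_linear_between M N pushforward"
  unfolding L2_bounded_linear_between_def
proof (intro conjI ballI allI)
  show "\<exists>C. \<forall>u\<in>L2 M. L2_norm N (pushforward u) \<le> C * L2_norm M u"
    by (intro exI[of _ 1]) (simp add: L2_norm_pushforward_le)
  show "pushforward (L2_add M u w) = L2_add N (pushforward u) (pushforward w)"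
    if "u \<in> L2 M" "w \<in> L2 M" for u w
    using that by (intro L2_eqI_inner) (auto simp: L2_inner_add_left simp flip: L2_inner_pushforward)
  show "pushforward (L2_scale M c u) = L2_scale N c (pushforward u)" if "u \<in> L2 M" for u c
    using that by (intro L2_eqI_inner) (auto simp: L2_inner_scale_left simp flip: L2_inner_pushforward)
qed simp

section \<open>Means and projections as conjugates under pullback and pushforward\<close>

text \<open>The mean is the inner product with the constant 1, and the pullback of a constant is the
  same constant.\<close>

lemma L2_mean_pullback:
  assumes u: "u \<in> L2 M"
  shows "L2_mean M u = pullback (L2_mean N (pushforward u))"
proof -
  interpret N: prob_space N
    by (rule prob_space_N)
  have "(\<integral>x. rep u x \<partial>M) = (\<integral>y. rep (pushforward u) y \<partial>N)"
    using L2_inner_pushforward[OF u, of "L2_class N (\<lambda>_. 1)"]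
      L2_inner_class[OF sq_integrable_rep[OF u], of "\<lambda>_. 1"]
      L2_inner_class[OF sq_integrable_rep[OF pushforward_in[OF u]], of "\<lambda>_. 1"]
    by (simp add: L2_class_rep u)
  then show ?thesis
    by (simp add: L2_mean_def)
qed

text \<open>By adjointness, testing the residual of \<open>u\<close> against a pullback amounts to
  testing the residual of \<open>pushforward u\<close> against an element of
  \<open>S\<close>.\<close>

lemma L2_proj_pullback:
  assumes u: "u \<in> L2 M"
    and S: "S \<subseteq> L2 N" "\<And>v w. \<lbrakk>v \<in> S; w \<in> S\<rbrakk> \<Longrightarrow> L2_diff N v w \<in> S"
    and p: "L2_proj N S (pushforward u) \<in> S"
      "\<And>t. t \<in> S \<Longrightarrow> L2_inner N (L2_diff N (pushforward u) (L2_proj N S (pushforward u))) t = 0"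
  shows "L2_proj M (pullback ` S) u = pullback (L2_proj N S (pushforward u))"
proof (rule L2_proj_eqI)
  let ?p = "L2_proj N S (pushforward u)"
  show "pullback ` S \<subseteq> L2 M"
    using S(1) by auto
  show "L2_diff M v w \<in> pullback ` S" if "v \<in> pullback ` S" "w \<in> pullback ` S" for v w
    using that S by (auto simp: subset_iff simp flip: L2_bounded_linear_between_diff[OF pullback_linear])
  show "L2_inner M (L2_diff M u (pullback ?p)) t = 0" if t: "t \<in> pullback ` S" for t
  proof -
    obtain t' where t': "t' \<in> S" "t' \<in> L2 N" "t = pullback t'"
      using t S(1) by blast
    have "?p \<in> L2 N"
      using p(1) S(1) by blast
    then show ?thesis
      using u t' p(2)[OF t'(1)]
      by (simp add: L2_inner_diff_left L2_inner_pushforward pushforward_pullback)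
  qed
qed (use u p in auto)

end

section \<open>Restriction to some coordinates of a product\<close>

text \<open>Adjacent factors \<open>\<kappa> \<circ> \<iota>\<close> cancel. The empty product would
  be the identity on the left but \<open>\<iota> \<circ> \<kappa>\<close> on the right, so at least
  one factor is required.\<close>

lemma op_prod_conjugate:
  assumes g: "g \<ge> 1"
    and P: "\<And>d u. \<lbrakk>d \<in> {1..g}; u \<in> U\<rbrakk> \<Longrightarrow> P d u = \<iota> (Q d (\<kappa> u))"
    and Q: "\<And>d v. \<lbrakk>d \<in> {1..g}; v \<in> V\<rbrakk> \<Longrightarrow> Q d v \<in> V"
    and \<iota>: "\<And>v. v \<in> V \<Longrightarrow> \<iota> v \<in> U \<and> \<kappa> (\<iota> v) = v" and \<kappa>: "\<And>u. u \<in> U \<Longrightarrow> \<kappa> u \<in> V"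
    and u: "u \<in> U"
  shows "op_prod P g u = \<iota> (op_prod Q g (\<kappa> u))"
proof -
  \<comment> \<open>Membership in \<open>V\<close> is carried through the induction because the
    cancellation holds only there.\<close>
  have "foldr (\<lambda>d T. P d \<circ> T) ds id u = \<iota> (foldr (\<lambda>d T. Q d \<circ> T) ds id (\<kappa> u)) \<and>
      foldr (\<lambda>d T. Q d \<circ> T) ds id (\<kappa> u) \<in> V" if "ds \<noteq> []" "set ds \<subseteq> {1..g}" for ds
    using that
  proof (induction ds rule: list_nonempty_induct)
    case (single d)
    then show ?case
      using P Q u \<kappa> by simp
  next
    case (cons d ds)
    then show ?case
      using P Q \<iota> by auto
  qed
  from this[of "[1..<Suc g]"] show ?thesis
    using g unfolding op_prod_def by fastforce
qed

lemma op_prod_in: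
  assumes Q: "\<And>d v. \<lbrakk>d \<in> {1..g}; v \<in> V\<rbrakk> \<Longrightarrow> Q d v \<in> V" and v: "v \<in> V"
  shows "op_prod Q g v \<in> V"
proof -
  have "foldr (\<lambda>d T. Q d \<circ> T) ds id v \<in> V" if "set ds \<subseteq> {1..g}" for ds
    using that by (induction ds) (auto simp: v Q)
  then show ?thesis
    unfolding op_prod_def by (metis atLeastLessThanSuc_atLeastAtMost set_upt subset_refl)
qed

lemma op_prod_fixed:
  assumes "\<And>d. d \<in> {1..g} \<Longrightarrow> Q d v = v"
  shows "op_prod Q g v = v"
  \<comment> \<open>The singleton \<open>{v}\<close> is invariant under every factor.\<close>
  using op_prod_in[of g "{v}" Q v] assms by auto

section \<open>Restriction and its section on Borel products\<close>

lemma space_borel_of: "space (borel_of T) = topspace T"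
  and sets_borel_of: "sets (borel_of T) = sigma_sets (topspace T) {U. openin T U}"
  unfolding borel_of_def by (auto intro!: space_measure_of sets_measure_of dest: openin_subset)

lemma space_prod_borel: "space (prod_borel X A) = (\<Pi>\<^sub>E i\<in>A. mspace (X i))"
  by (simp add: prod_borel_def space_borel_of)

lemma continuous_map_borel_of:
  assumes "continuous_map S T f"
  shows "f \<in> measurable (borel_of S) (borel_of T)"
proof -
  show ?thesis
    unfolding borel_of_def[of T]
  proof (rule measurable_measure_of)
    show "f -` U \<inter> space (borel_of S) \<in> sets (borel_of S)" if "U \<in> {U. openin T U}" for U
    proof -
      have "openin S {x \<in> topspace S. f x \<in> U}"
        using assms that by (auto simp: continuous_map_def)
      moreover have "f -` U \<inter> topspace S = {x \<in> topspace S. f x \<in> U}"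
        by auto
      ultimately show ?thesis
        by (simp add: space_borel_of sets_borel_of sigma_sets.Basic)
    qed
  qed (use assms in \<open>auto simp: space_borel_of continuous_map_def dest: openin_subset\<close>)
qed

lemma measurable_restrict_prod_borel:
  assumes "I \<subseteq> A"
  shows "(\<lambda>x. restrict x I) \<in> measurable (prod_borel X A) (prod_borel X I)"
  unfolding prod_borel_def
proof (rule continuous_map_borel_of)
  show "continuous_map (product_topology (\<lambda>i. mtopology_of (X i)) A)
      (product_topology (\<lambda>i. mtopology_of (X i)) I) (\<lambda>x. restrict x I)"
    unfolding continuous_map_componentwise
    using assms by (auto intro: continuous_map_product_projection)
qed

text \<open>Each coordinate of the map is a projection or a constant, so the map is continuous.
  Outside \<open>A\<close> it inherits the value \<open>undefined\<close> from \<open>z\<close>,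
  which keeps it inside the product over \<open>A\<close>.\<close>

lemma measurable_section_prod_borel:
  assumes "I \<subseteq> A" and z: "z \<in> (\<Pi>\<^sub>E i\<in>A. mspace (X i))"
  shows "(\<lambda>y i. if i \<in> I then y i else z i) \<in> measurable (prod_borel X I) (prod_borel X A)"
  unfolding prod_borel_def
proof (rule continuous_map_borel_of)
  have "continuous_map (product_topology (\<lambda>i. mtopology_of (X i)) I) (mtopology_of (X k))
      (\<lambda>y. if k \<in> I then y k else z k)" if "k \<in> A" for k
    using z that by (cases "k \<in> I") (auto intro: continuous_map_product_projection)
  then show "continuous_map (product_topology (\<lambda>i. mtopology_of (X i)) I)
      (product_topology (\<lambda>i. mtopology_of (X i)) A) (\<lambda>y i. if i \<in> I then y i else z i)"
    unfolding continuous_map_componentwise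
    using assms by (auto simp: extensional_def PiE_iff)
qed

lemma measure_retraction_marginal:
  assumes "prob_space \<pi>" and sets: "sets \<pi> = sets (prod_borel X A)" and "I \<subseteq> A"
    and z: "z \<in> space \<pi>"
  shows "measure_retraction \<pi> (marginal X I \<pi>) (\<lambda>x. restrict x I) (\<lambda>y i. if i \<in> I then y i else z i)"
proof -
  have z': "z \<in> (\<Pi>\<^sub>E i\<in>A. mspace (X i))"
    using z sets_eq_imp_space_eq[OF sets] by (simp add: space_prod_borel)
  have sets_marginal [measurable_cong]: "sets (marginal X I \<pi>) = sets (prod_borel X I)"
    by (simp add: marginal_def)
  note sets [measurable_cong]
  have "(\<lambda>x. restrict x I) \<in> measurable \<pi> (marginal X I \<pi>)"
    using measurable_restrict_prod_borel[OF \<open>I \<subseteq> A\<close>] by measurable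
  moreover have "(\<lambda>y i. if i \<in> I then y i else z i) \<in> measurable (marginal X I \<pi>) \<pi>"
    using measurable_section_prod_borel[OF \<open>I \<subseteq> A\<close> z'] by measurable
  moreover have "restrict (\<lambda>i. if i \<in> I then y i else z i) I = y" if "y \<in> space (marginal X I \<pi>)" for y
    using that by (auto simp: marginal_def space_prod_borel PiE_def extensional_def restrict_def)
  \<comment> \<open>\<open>distr\<close> sees its target only through the space and the measurable
    sets, and the marginal shares these with \<open>prod_borel X I\<close>.\<close>
  moreover have "distr \<pi> (marginal X I \<pi>) (\<lambda>x. restrict x I) = marginal X I \<pi>"
    unfolding marginal_def by (rule distr_cong) simp_all
  ultimately show ?thesis
    using assms(1) by (simp add: measure_retraction_def measure_retraction_axioms_def)
qed

text \<open>Functions of the restricted point ignore the coordinates in \<open>A - I\<close>.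
  Conversely, a function constant in those coordinates does not change when they are frozen at
  \<open>z\<close>, so it descends along the section.\<close>

lemma pullback_coord_const:
  fixes z :: "nat \<Rightarrow> 'a"
  assumes \<pi>: "prob_space \<pi>" and sets: "sets \<pi> = sets (prod_borel X A)" and IA: "I \<subseteq> A"
    and z: "z \<in> space \<pi>" and J: "J \<subseteq> I"
  shows "measure_retraction.pullback \<pi> (\<lambda>x. restrict x I) ` coord_const (marginal X I \<pi>) J =
    coord_const \<pi> (J \<union> (A - I))" (is "_ ` ?SI = ?S")
proof -
  let ?N = "marginal X I \<pi>"
  define r where "r = (\<lambda>x :: nat \<Rightarrow> 'a. restrict x I)"
  define s where "s = (\<lambda>y i. if i \<in> I then y i else z i)"
  interpret measure_retraction \<pi> ?N r s
    unfolding r_def s_def by (rule measure_retraction_marginal) fact+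
  \<comment> \<open>\<open>coord_const\<close> compares points at every index outside its second
    argument, even outside \<open>A\<close>; there all points share this default value.\<close>
  have ext: "x i = undefined" if "x \<in> space \<pi>" "i \<notin> A" for x i
    using that sets_eq_imp_space_eq[OF sets] by (auto simp: space_prod_borel)
  show ?thesis
    unfolding r_def[symmetric]
  proof (intro subset_antisym image_subsetI subsetI)
    fix v assume "v \<in> ?SI"
    then obtain h where h: "h \<in> sq_integrable ?N" "v = L2_class ?N h"
      and const: "\<forall>x\<in>space ?N. \<forall>y\<in>space ?N. (\<forall>i. i \<notin> J \<longrightarrow> x i = y i) \<longrightarrow> h x = h y"
      by (rule coord_constE)
    have "L2_class \<pi> (\<lambda>x. h (r x)) \<in> ?S"
    proof (rule coord_constI)
      fix x y assume xy: "x \<in> space \<pi>" "y \<in> space \<pi>" "\<And>i. i \<notin> J \<union> (A - I) \<Longrightarrow> x i = y i"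
      have "r x \<in> space ?N" "r y \<in> space ?N"
        using xy(1,2) measurable_space[OF r] by auto
      moreover have "r x i = r y i" if "i \<notin> J" for i
        using xy(3)[of i] that by (auto simp: r_def restrict_def)
      ultimately show "h (r x) = h (r y)"
        using const by blast
    qed (use h in simp)
    then show "pullback v \<in> ?S"
      using h by simp
  next
    fix u assume "u \<in> ?S"
    then obtain f where f: "f \<in> sq_integrable \<pi>" "u = L2_class \<pi> f"
      and const: "\<forall>x\<in>space \<pi>. \<forall>y\<in>space \<pi>. (\<forall>i. i \<notin> J \<union> (A - I) \<longrightarrow> x i = y i) \<longrightarrow> f x = f y"
      by (rule coord_constE)
    have f_s: "f (s (r x)) = f x" if x: "x \<in> space \<pi>" for x
    proof -
      have "s (r x) \<in> space \<pi>"
        using x measurable_space[OF r] measurable_space[OF s] by blast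
      moreover have "s (r x) i = x i" if "i \<notin> J \<union> (A - I)" for i
        using that ext[OF x, of i] ext[OF z, of i] by (auto simp: r_def s_def)
      ultimately show ?thesis
        using const x by blast
    qed
    have "L2_class ?N (\<lambda>y. f (s y)) \<in> ?SI"
    proof (rule coord_constI)
      show "(\<lambda>y. f (s y)) \<in> sq_integrable ?N"
        using f(1) f_s by (rule sq_integrable_descend)
      fix x y assume xy: "x \<in> space ?N" "y \<in> space ?N" "\<And>i. i \<notin> J \<Longrightarrow> x i = y i"
      have "s x \<in> space \<pi>" "s y \<in> space \<pi>"
        using xy(1,2) measurable_space[OF s] by blast+
      moreover have "s x i = s y i" if "i \<notin> J \<union> (A - I)" for i
        using that xy(3) by (auto simp: s_def)
      ultimately show "f (s x) = f (s y)"
        using const by blast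
    qed
    moreover have "u = pullback (L2_class ?N (\<lambda>y. f (s y)))"
      unfolding f(2) using f(1) f_s by (rule pullback_descend[symmetric])
    ultimately show "u \<in> pullback ` ?SI"
      by blast
  qed
qed

theorem proposition4p7:
  fixes K g :: nat
    and X :: "nat \<Rightarrow> 'a metric"
    and \<pi> :: "(nat \<Rightarrow> 'a) measure"
    and I :: "nat set"
    and J :: "nat \<Rightarrow> nat set"
  assumes "K \<ge> 3"
    and "\<And>k. k \<in> {1..K} \<Longrightarrow> mcomplete_of (X k)"
    and "\<And>k. k \<in> {1..K} \<Longrightarrow> separable_space (mtopology_of (X k))"
    and "prob_space \<pi>"
    and "sets \<pi> = sets (prod_borel X {1..K})"
    and "I \<subset> {1..K}"
    and "card I \<ge> 2"
    and "\<And>d. d \<in> {1..g} \<Longrightarrow> J d \<noteq> {} \<and> J d \<subset> I"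
    and "(\<Union>d\<in>{1..g}. J d) = I"
  defines "\<pi>I \<equiv> marginal X I \<pi>"
    and "FF \<equiv> \<lambda>d. coord_const \<pi> (J d \<union> ({1..K} - I))"
    and "FI \<equiv> \<lambda>d. coord_const (marginal X I \<pi>) (J d)"
  shows
    "L2_spectrum \<pi> (\<lambda>u. L2_diff \<pi> (op_prod (\<lambda>d. L2_proj \<pi> (FF d)) g u) (L2_mean \<pi> u))
       = L2_spectrum \<pi>I (\<lambda>u. L2_diff \<pi>I (op_prod (\<lambda>d. L2_proj \<pi>I (FI d)) g u) (L2_mean \<pi>I u))
     \<and> (\<forall>v :: nat \<Rightarrow> real.
          (\<forall>d\<in>{1..g}. 0 < v d \<and> v d < 1) \<and> (\<Sum>d\<in>{1..g}. v d) = 1 \<longrightarrow>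
          L2_spectrum \<pi> (\<lambda>u. L2_diff \<pi>
              (L2_sum \<pi> (\<lambda>d. L2_scale \<pi> (complex_of_real (v d)) (L2_proj \<pi> (FF d) u)) {1..g})
              (L2_mean \<pi> u))
          = L2_spectrum \<pi>I (\<lambda>u. L2_diff \<pi>I
              (L2_sum \<pi>I (\<lambda>d. L2_scale \<pi>I (complex_of_real (v d)) (L2_proj \<pi>I (FI d) u)) {1..g})
              (L2_mean \<pi>I u)))"
proof -
  have "space \<pi> \<noteq> {}"
    using assms(4) by (rule prob_space.not_empty)
  then obtain z where z: "z \<in> space \<pi>"
    by blast
  have IA: "I \<subseteq> {1..K}"
    using assms(6) by blast
  define r where "r = (\<lambda>x :: nat \<Rightarrow> 'a. restrict x I)"
  define s where "s = (\<lambda>y i. if i \<in> I then y i else z i)"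
  interpret measure_retraction \<pi> \<pi>I r s
    unfolding \<pi>I_def r_def s_def using assms(4,5) IA z by (rule measure_retraction_marginal)
  interpret N: prob_space \<pi>I
    by (rule prob_space_N)
  have "I \<noteq> {}"
    using assms(7) by auto
  \<comment> \<open>An empty family would have empty union, but \<open>I\<close> is nonempty. The
    conjugation of products relies on this.\<close>
  then have g: "g \<ge> 1"
    using assms(9) by (cases "g = 0") auto

  let ?P = "\<lambda>d. L2_proj \<pi> (FF d)" and ?Q = "\<lambda>d. L2_proj \<pi>I (FI d)"
  let ?one = "L2_class \<pi>I (\<lambda>_. 1)"
  have FF: "FF d = pullback ` FI d" if "d \<in> {1..g}" for d
    using pullback_coord_const[OF assms(4,5) IA z, of "J d"] assms(8)[OF that]
    by (auto simp: FF_def FI_def r_def)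
  have FI: "FI d = coord_const \<pi>I (J d)" for d
    by (simp add: FI_def \<pi>I_def)
  have Q_in: "?Q d v \<in> L2 \<pi>I" if "v \<in> L2 \<pi>I" for d v
    unfolding FI using N.prob_space_axioms that by (rule L2_proj_coord_const_in_L2)
  have Q_one: "?Q d ?one = ?one" for d
    unfolding FI using N.prob_space_axioms by (rule L2_proj_coord_const_const)
  have P: "?P d u = pullback (?Q d (pushforward u))" if "d \<in> {1..g}" "u \<in> L2 \<pi>" for d u
    unfolding FF[OF that(1)] FI
    using that(2) coord_const_subset coord_const_diff
      L2_proj_coord_const_in[OF N.prob_space_axioms pushforward_in[OF that(2)]]
      L2_proj_coord_const_orthogonal[OF N.prob_space_axioms pushforward_in[OF that(2)]]
    by (rule L2_proj_pullback)

  \<comment> \<open>One argument for both identities: whenever \<open>B\<close> is the conjugate of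
    \<open>A\<close> and \<open>A\<close> fixes constants, subtracting the mean makes
    \<open>?one\<close> a nonzero element of the kernel, as \<open>L2_spectrum_retract\<close>
    demands.\<close>
  have spectrum: "L2_spectrum \<pi> (\<lambda>u. L2_diff \<pi> (B u) (L2_mean \<pi> u)) =
      L2_spectrum \<pi>I (\<lambda>u. L2_diff \<pi>I (A u) (L2_mean \<pi>I u))"
    if B: "\<And>u. u \<in> L2 \<pi> \<Longrightarrow> B u = pullback (A (pushforward u))"
      and A: "\<And>v. v \<in> L2 \<pi>I \<Longrightarrow> A v \<in> L2 \<pi>I" and A_one: "A ?one = ?one" for A B
  proof (rule L2_spectrum_retract[OF pullback_linear pushforward_linear pushforward_pullback])
    have mean_in: "L2_mean \<pi>I v \<in> L2 \<pi>I" for v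
      by (simp add: L2_mean_def)
    show "L2_diff \<pi>I (A v) (L2_mean \<pi>I v) \<in> L2 \<pi>I" if "v \<in> L2 \<pi>I" for v
      using A mean_in that by simp
    show "L2_diff \<pi> (B u) (L2_mean \<pi> u) =
        pullback (L2_diff \<pi>I (A (pushforward u)) (L2_mean \<pi>I (pushforward u)))" if "u \<in> L2 \<pi>" for u
      using that A mean_in
      by (simp add: B L2_mean_pullback L2_bounded_linear_between_diff[OF pullback_linear])
    show "?one \<in> L2 \<pi>I"
      by simp
    show "?one \<noteq> L2_class \<pi>I (\<lambda>_. 0)"
      by (simp add: L2_class_eq_iff)
    \<comment> \<open>The chosen representative of \<open>?one\<close> is known to be 1 only almost
      everywhere.\<close>
    have "(\<integral>x. rep ?one x \<partial>\<pi>I) = (\<integral>x. 1 \<partial>\<pi>I)"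
      using sq_integrable_rep_class[of "\<lambda>_. 1" \<pi>I] AE_rep_class[of "\<lambda>_. 1" \<pi>I]
      by (intro integral_cong_AE) (simp_all add: sq_integrable_measurable)
    then show "L2_diff \<pi>I (A ?one) (L2_mean \<pi>I ?one) = L2_class \<pi>I (\<lambda>_. 0)"
      by (simp add: A_one L2_mean_def N.prob_space)
  qed

  have "L2_spectrum \<pi> (\<lambda>u. L2_diff \<pi> (op_prod ?P g u) (L2_mean \<pi> u)) =
      L2_spectrum \<pi>I (\<lambda>u. L2_diff \<pi>I (op_prod ?Q g u) (L2_mean \<pi>I u))"
  proof (rule spectrum)
    show "op_prod ?P g u = pullback (op_prod ?Q g (pushforward u))" if "u \<in> L2 \<pi>" for u
      using g P Q_in _ _ that
      by (rule op_prod_conjugate[where U = "L2 \<pi>" and V = "L2 \<pi>I"]) (auto simp: pushforward_pullback)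
    show "op_prod ?Q g v \<in> L2 \<pi>I" if "v \<in> L2 \<pi>I" for v
      using Q_in that by (rule op_prod_in)
    show "op_prod ?Q g ?one = ?one"
      using Q_one by (rule op_prod_fixed)
  qed
  moreover have "L2_spectrum \<pi> (\<lambda>u. L2_diff \<pi>
        (L2_sum \<pi> (\<lambda>d. L2_scale \<pi> (complex_of_real (v d)) (?P d u)) {1..g}) (L2_mean \<pi> u)) =
      L2_spectrum \<pi>I (\<lambda>u. L2_diff \<pi>I
        (L2_sum \<pi>I (\<lambda>d. L2_scale \<pi>I (complex_of_real (v d)) (?Q d u)) {1..g}) (L2_mean \<pi>I u))"
    if v: "(\<Sum>d\<in>{1..g}. v d) = 1" for v :: "nat \<Rightarrow> real"
  proof (rule spectrum)
    show "L2_sum \<pi> (\<lambda>d. L2_scale \<pi> (complex_of_real (v d)) (?P d u)) {1..g} =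
        pullback (L2_sum \<pi>I (\<lambda>d. L2_scale \<pi>I (complex_of_real (v d)) (?Q d (pushforward u))) {1..g})"
      if u: "u \<in> L2 \<pi>" for u
    proof -
      have "L2_scale \<pi> (complex_of_real (v d)) (?P d u) =
          pullback (L2_scale \<pi>I (complex_of_real (v d)) (?Q d (pushforward u)))" if "d \<in> {1..g}" for d
        using u that by (simp add: P Q_in L2_bounded_linear_between_scale[OF pullback_linear])
      then have "L2_sum \<pi> (\<lambda>d. L2_scale \<pi> (complex_of_real (v d)) (?P d u)) {1..g} =
          L2_sum \<pi> (\<lambda>d. pullback (L2_scale \<pi>I (complex_of_real (v d)) (?Q d (pushforward u)))) {1..g}"
        unfolding L2_sum_def by (intro arg_cong[where f = "L2_class \<pi>"] ext sum.cong refl) simp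
      also have "\<dots> = pullback
          (L2_sum \<pi>I (\<lambda>d. L2_scale \<pi>I (complex_of_real (v d)) (?Q d (pushforward u))) {1..g})"
        using u Q_in by (intro L2_bounded_linear_between_sum[OF pullback_linear, symmetric]) auto
      finally show ?thesis .
    qed
    show "L2_sum \<pi>I (\<lambda>d. L2_scale \<pi>I (complex_of_real (v d)) (?Q d w)) {1..g} \<in> L2 \<pi>I"
      if "w \<in> L2 \<pi>I" for w
      using that Q_in by (intro L2_sum_in) auto
    \<comment> \<open>Each projection fixes \<open>?one\<close>, so the combination multiplies it by
      the total weight, which is 1.\<close>
    have "L2_sum \<pi>I (\<lambda>d. L2_scale \<pi>I (complex_of_real (v d)) (?Q d ?one)) {1..g} =
        L2_class \<pi>I (\<lambda>_. \<Sum>d\<in>{1..g}. complex_of_real (v d))"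
      by (rule L2_sum_class) (simp_all add: Q_one)
    also have "(\<Sum>d\<in>{1..g}. complex_of_real (v d)) = 1"
      using v by (simp flip: of_real_sum)
    finally show "L2_sum \<pi>I (\<lambda>d. L2_scale \<pi>I (complex_of_real (v d)) (?Q d ?one)) {1..g} = ?one" .
  qed
  ultimately show ?thesis
    by simp
qed

end
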